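(* Let $\Omega\subset\mathbb{R}^N$ be a bounded smooth domain, $\delta>0$, $1<r<+\infty$, and let $g:\Omega\times\mathbb{R}^+\to\mathbb{R}$ be a Carathéodory function, bounded below, such that $s\mapsto\frac{g(x,s)}{s^{r-1}}$ is decreasing on $\mathbb{R}^+$ for a.e. $x\in\Omega$. Let $u,v\in L^\infty(\Omega)\cap W^{1,r}_0(\Omega)$ with $u>0$, $v>0$ in $\Omega$, $\int_\Omega u^{1-\delta}dx<+\infty$, $\int_\Omega v^{1-\delta}dx<+\infty$, and $$-\Delta_ru\le\frac{1}{u^\delta}+g(x,u),\qquad -\Delta_rv\ge\frac{1}{v^\delta}+g(x,v)$$ weakly in $W^{-1,\frac{r}{r-1}}(\Omega)$. Suppose moreover there exist a positive function $u_0\in L^\infty(\Omega)$ and constants $c,C>0$ with $cu_0\le u,v\le Cu_0$ and $$\int_\Omega|g(x,cu_0)|u_0\,dx<+\infty,\qquad\int_\Omega|g(x,Cu_0)|u_0\,dx<+\infty.$$ Then $u\le v$ in $\Omega$.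
   Context: $\Delta_r u=\mathrm{div}(|\nabla u|^{r-2}\nabla u)$. *)

theory Defs
  imports "HOL-Analysis.Analysis"
begin

definition pdiff :: "(real^'n \<Rightarrow> real) \<Rightarrow> 'n \<Rightarrow> real^'n \<Rightarrow> real" where
  "pdiff f i x = deriv (\<lambda>t. f (x + t *\<^sub>R axis i 1)) 0"

definition grad :: "(real^'n \<Rightarrow> real) \<Rightarrow> real^'n \<Rightarrow> real^'n" where
  "grad f x = (\<chi> i. pdiff f i x)"

coinductive smooth :: "(real^'n \<Rightarrow> real) \<Rightarrow> bool" where
  "\<lbrakk> continuous_on UNIV f;
     \<forall>i x. ((\<lambda>t. f (x + t *\<^sub>R axis i 1)) has_real_derivative D i x) (at 0);
     \<forall>i. smooth (D i) \<rbrakk> \<Longrightarrow> smooth f"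

definition test_fun :: "(real^'n) set \<Rightarrow> (real^'n \<Rightarrow> real) \<Rightarrow> bool" where
  "test_fun \<Omega> \<phi> \<longleftrightarrow> smooth \<phi> \<and> (\<exists>K. compact K \<and> K \<subseteq> \<Omega> \<and> (\<forall>x. x \<notin> K \<longrightarrow> \<phi> x = 0))"

definition bounded_smooth_domain :: "(real^'n) set \<Rightarrow> bool" where
  "bounded_smooth_domain \<Omega> \<longleftrightarrow> open \<Omega> \<and> connected \<Omega> \<and> \<Omega> \<noteq> {} \<and> bounded \<Omega> \<and>
     (\<forall>p\<in>frontier \<Omega>. \<exists>U \<psi>. open U \<and> p \<in> U \<and> smooth \<psi> \<and>
        (\<forall>x\<in>U. grad \<psi> x \<noteq> 0) \<and> \<Omega> \<inter> U = {x\<in>U. \<psi> x < 0})"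

definition Lp_fun :: "(real^'n) set \<Rightarrow> real \<Rightarrow> (real^'n \<Rightarrow> real) \<Rightarrow> bool" where
  "Lp_fun \<Omega> r u \<longleftrightarrow> u \<in> borel_measurable (lebesgue_on \<Omega>) \<and>
     integrable (lebesgue_on \<Omega>) (\<lambda>x. \<bar>u x\<bar> powr r)"

definition Linf_fun :: "(real^'n) set \<Rightarrow> (real^'n \<Rightarrow> real) \<Rightarrow> bool" where
  "Linf_fun \<Omega> u \<longleftrightarrow> u \<in> borel_measurable (lebesgue_on \<Omega>) \<and>
     (\<exists>M. AE x in lebesgue_on \<Omega>. \<bar>u x\<bar> \<le> M)"

definition weak_grad :: "(real^'n) set \<Rightarrow> (real^'n \<Rightarrow> real) \<Rightarrow> (real^'n \<Rightarrow> real^'n) \<Rightarrow> bool" where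
  "weak_grad \<Omega> u G \<longleftrightarrow> G \<in> borel_measurable (lebesgue_on \<Omega>) \<and>
     (\<forall>\<phi> i. test_fun \<Omega> \<phi> \<longrightarrow>
        (\<integral>x. u x * pdiff \<phi> i x \<partial>lebesgue_on \<Omega>) = - (\<integral>x. G x $ i * \<phi> x \<partial>lebesgue_on \<Omega>))"

definition W01_fun :: "(real^'n) set \<Rightarrow> real \<Rightarrow> (real^'n \<Rightarrow> real) \<Rightarrow> (real^'n \<Rightarrow> real^'n) \<Rightarrow> bool" where
  "W01_fun \<Omega> r u G \<longleftrightarrow> Lp_fun \<Omega> r u \<and> weak_grad \<Omega> u G \<and>
     integrable (lebesgue_on \<Omega>) (\<lambda>x. norm (G x) powr r) \<and>
     (\<exists>\<phi>::nat \<Rightarrow> real^'n \<Rightarrow> real. (\<forall>k. test_fun \<Omega> (\<phi> k)) \<and>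
        (\<lambda>k. (\<integral>x. \<bar>\<phi> k x - u x\<bar> powr r \<partial>lebesgue_on \<Omega>)
            + (\<integral>x. norm (grad (\<phi> k) x - G x) powr r \<partial>lebesgue_on \<Omega>)) \<longlonglongrightarrow> 0)"

definition weak_subsol :: "(real^'n) set \<Rightarrow> real \<Rightarrow> real \<Rightarrow> (real^'n \<Rightarrow> real \<Rightarrow> real)
    \<Rightarrow> (real^'n \<Rightarrow> real) \<Rightarrow> bool" where
  "weak_subsol \<Omega> r \<delta> g u \<longleftrightarrow> (\<exists>G. W01_fun \<Omega> r u G \<and>
     (\<forall>\<phi>. test_fun \<Omega> \<phi> \<and> (\<forall>x. 0 \<le> \<phi> x) \<longrightarrow>
        integrable (lebesgue_on \<Omega>) (\<lambda>x. (u x powr (-\<delta>) + g x (u x)) * \<phi> x) \<and>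
        (\<integral>x. norm (G x) powr (r - 2) * (G x \<bullet> grad \<phi> x) \<partial>lebesgue_on \<Omega>)
          \<le> (\<integral>x. (u x powr (-\<delta>) + g x (u x)) * \<phi> x \<partial>lebesgue_on \<Omega>)))"

definition weak_supersol :: "(real^'n) set \<Rightarrow> real \<Rightarrow> real \<Rightarrow> (real^'n \<Rightarrow> real \<Rightarrow> real)
    \<Rightarrow> (real^'n \<Rightarrow> real) \<Rightarrow> bool" where
  "weak_supersol \<Omega> r \<delta> g v \<longleftrightarrow> (\<exists>G. W01_fun \<Omega> r v G \<and>
     (\<forall>\<phi>. test_fun \<Omega> \<phi> \<and> (\<forall>x. 0 \<le> \<phi> x) \<longrightarrow>
        integrable (lebesgue_on \<Omega>) (\<lambda>x. (v x powr (-\<delta>) + g x (v x)) * \<phi> x) \<and>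
        (\<integral>x. norm (G x) powr (r - 2) * (G x \<bullet> grad \<phi> x) \<partial>lebesgue_on \<Omega>)
          \<ge> (\<integral>x. (v x powr (-\<delta>) + g x (v x)) * \<phi> x \<partial>lebesgue_on \<Omega>)))"

definition caratheodory :: "(real^'n) set \<Rightarrow> (real^'n \<Rightarrow> real \<Rightarrow> real) \<Rightarrow> bool" where
  "caratheodory \<Omega> g \<longleftrightarrow> (\<forall>s>0. (\<lambda>x. g x s) \<in> borel_measurable (lebesgue_on \<Omega>)) \<and>
     (AE x in lebesgue_on \<Omega>. continuous_on {0<..} (g x))"

end

theory Submission
  imports Defs
begin

text \<open>
  For \<open>\<beta> = 1\<close> and \<open>\<beta> = r\<close> put \<open>w\<^sub>\<beta> = u powr \<beta> * v powr (1 - \<beta>) / (1 + (v / u) powr m)\<close>, which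
  replace the classical \<open>(u\<^sup>r - v\<^sup>r)\<^sup>+\<close> divided by \<open>u powr (r - 1)\<close>, respectively \<open>v powr (r - 1)\<close>. Testing the
  inequality for \<open>u\<close> with \<open>w\<^sub>1\<close>, the one for \<open>v\<close> with \<open>w\<^sub>r\<close>, and subtracting, the left-hand side is
  nonnegative by a Picone-type inequality. As \<open>m \<rightarrow> \<infinity>\<close>, the right-hand side tends to the integral over
  \<open>{u > v}\<close> of \<open>u\<^sup>r\<close> times the difference of the quotients \<open>(s powr (-\<delta>) + g x s) / s powr (r - 1)\<close> at
  \<open>s = u\<close> and \<open>s = v\<close>, which is negative unless \<open>{u > v}\<close> is a null set.

  The functions \<open>w\<^sub>\<beta>\<close> are admissible without mollification: if \<open>\<phi>\<^sub>k \<rightarrow> u\<close> and \<open>\<psi>\<^sub>k \<rightarrow> v\<close> are test functions,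
  a smooth function of \<open>\<phi>\<^sub>k, \<psi>\<^sub>k\<close> multiplied by \<open>\<phi>\<^sub>j\<^sup>2 / (e\<^sup>2 + \<phi>\<^sub>j\<^sup>2)\<close> is again a test function. One lets
  \<open>k \<rightarrow> \<infinity>\<close> with the support fixed by \<open>\<phi>\<^sub>j\<close>, then \<open>j \<rightarrow> \<infinity>\<close>, and finally \<open>e \<rightarrow> 0\<close>.
\<close>

section \<open>Smooth functions\<close>

text \<open>The constructors are closed under partial derivatives, so coinduction makes every member smooth.\<close>
inductive smooth_closure :: "(real^'n \<Rightarrow> real) \<Rightarrow> bool" where
  base: "smooth f \<Longrightarrow> smooth_closure f"
| const: "smooth_closure (\<lambda>x. c)"
| add: "smooth_closure f \<Longrightarrow> smooth_closure g \<Longrightarrow> smooth_closure (\<lambda>x. f x + g x)"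
| mult: "smooth_closure f \<Longrightarrow> smooth_closure g \<Longrightarrow> smooth_closure (\<lambda>x. f x * g x)"
| inverse: "smooth_closure f \<Longrightarrow> (\<And>x. f x \<noteq> 0) \<Longrightarrow> smooth_closure (\<lambda>x. inverse (f x))"
| exp: "smooth_closure f \<Longrightarrow> smooth_closure (\<lambda>x. exp (f x))"
| ln: "smooth_closure f \<Longrightarrow> (\<And>x. f x > 0) \<Longrightarrow> smooth_closure (\<lambda>x. ln (f x))"

lemma smooth_continuous: "smooth f \<Longrightarrow> continuous_on UNIV f"
  by (erule smooth.cases) simp

lemma smooth_partials:
  assumes "smooth f"
  obtains D where "\<And>i x. ((\<lambda>t. f (x + t *\<^sub>R axis i 1)) has_real_derivative D i x) (at 0)"
    "\<And>i. smooth (D i)"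
proof -
  from assms have "\<exists>D. (\<forall>i x. ((\<lambda>t. f (x + t *\<^sub>R axis i 1)) has_real_derivative D i x) (at 0)) \<and>
    (\<forall>i. smooth (D i))"
    by (rule smooth.cases) blast
  with that show thesis by blast
qed

lemma smooth_closure_continuous: "smooth_closure f \<Longrightarrow> continuous_on UNIV f"
proof (induction rule: smooth_closure.induct)
  case (ln f)
  then show ?case by (intro continuous_intros) (auto simp: less_imp_neq[symmetric])
qed (simp_all add: smooth_continuous continuous_on_add continuous_on_mult continuous_on_inverse
      continuous_on_exp)

lemma smooth_closure_partial:
  fixes f :: "real^'n \<Rightarrow> real"
  assumes "smooth_closure f"
  shows "\<exists>D. smooth_closure D \<and>
    (\<forall>x. ((\<lambda>t. f (x + t *\<^sub>R axis i 1)) has_real_derivative D x) (at 0))"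
  using assms
proof (induction rule: smooth_closure.induct)
  case (base f)
  obtain D where "\<And>i x. ((\<lambda>t. f (x + t *\<^sub>R axis i 1)) has_real_derivative D i x) (at 0)"
    "\<And>i. smooth (D i)"
    using smooth_partials[OF base] by metis
  then show ?case
    by (intro exI[of _ "D i"]) (auto intro: smooth_closure.base)
next
  case (const c)
  show ?case
    by (intro exI[of _ "\<lambda>x. 0"]) (auto intro: smooth_closure.const)
next
  case (add f g)
  then obtain F G where *: "smooth_closure F" "smooth_closure G"
    "\<And>x. ((\<lambda>t. f (x + t *\<^sub>R axis i 1)) has_real_derivative F x) (at 0)"
    "\<And>x. ((\<lambda>t. g (x + t *\<^sub>R axis i 1)) has_real_derivative G x) (at 0)"
    by blast
  show ?case
    by (intro exI[of _ "\<lambda>x. F x + G x"] conjI allI smooth_closure.add DERIV_add *)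
next
  case (mult f g)
  then obtain F G where *: "smooth_closure F" "smooth_closure G"
    "\<And>x. ((\<lambda>t. f (x + t *\<^sub>R axis i 1)) has_real_derivative F x) (at 0)"
    "\<And>x. ((\<lambda>t. g (x + t *\<^sub>R axis i 1)) has_real_derivative G x) (at 0)"
    by blast
  have "((\<lambda>t. f (x + t *\<^sub>R axis i 1) * g (x + t *\<^sub>R axis i 1))
      has_real_derivative F x * g x + G x * f x) (at 0)" for x
    using DERIV_mult[OF *(3) *(4), of x x] by simp
  with mult * show ?case
    by (intro exI[of _ "\<lambda>x. F x * g x + G x * f x"] conjI allI smooth_closure.add smooth_closure.mult)
next
  case (inverse f)
  then obtain F where *: "smooth_closure F"
    "\<And>x. ((\<lambda>t. f (x + t *\<^sub>R axis i 1)) has_real_derivative F x) (at 0)"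
    by blast
  \<comment> \<open>The sign is written as the factor \<open>-1\<close> because the closure offers
    constants and products but no constructor for negation.\<close>
  have "((\<lambda>t. inverse (f (x + t *\<^sub>R axis i 1)))
      has_real_derivative (-1) * (inverse (f x) * F x * inverse (f x))) (at 0)" for x
    using DERIV_inverse'[OF *(2), of x] inverse(2) by simp
  with inverse * show ?case
    by (intro exI[of _ "\<lambda>x. (-1) * (inverse (f x) * F x * inverse (f x))"] conjI allI
        smooth_closure.mult smooth_closure.const smooth_closure.inverse)
next
  case (exp f)
  then obtain F where *: "smooth_closure F"
    "\<And>x. ((\<lambda>t. f (x + t *\<^sub>R axis i 1)) has_real_derivative F x) (at 0)"
    by blast
  have "((\<lambda>t. exp (f (x + t *\<^sub>R axis i 1))) has_real_derivative exp (f x) * F x) (at 0)" for x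
    using DERIV_fun_exp[OF *(2), of x] by simp
  with exp * show ?case
    by (intro exI[of _ "\<lambda>x. exp (f x) * F x"] conjI allI smooth_closure.mult smooth_closure.exp)
next
  case (ln f)
  then obtain F where *: "smooth_closure F"
    "\<And>x. ((\<lambda>t. f (x + t *\<^sub>R axis i 1)) has_real_derivative F x) (at 0)"
    by blast
  have "((\<lambda>t. ln (f (x + t *\<^sub>R axis i 1))) has_real_derivative inverse (f x) * F x) (at 0)" for x
    using DERIV_chain'[OF *(2) DERIV_ln, of x] ln(2) by (simp add: mult.commute)
  moreover have "f x \<noteq> 0" for x using ln(2)[of x] by simp
  ultimately show ?case using ln *
    by (intro exI[of _ "\<lambda>x. inverse (f x) * F x"] conjI allI smooth_closure.mult smooth_closure.inverse)
qed

lemma smooth_closure_imp_smooth: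
  assumes "smooth_closure f"
  shows "smooth f"
  using assms
proof (coinduction arbitrary: f)
  case smooth
  obtain D where D: "\<And>i. smooth_closure (D i)"
    "\<And>i x. ((\<lambda>t. f (x + t *\<^sub>R axis i 1)) has_real_derivative D i x) (at 0)"
    using choice[of "\<lambda>i D. smooth_closure D \<and>
      (\<forall>x. ((\<lambda>t. f (x + t *\<^sub>R axis i 1)) has_real_derivative D x) (at 0))"]
      smooth_closure_partial[OF smooth] by metis
  show ?case
  proof (intro exI[of _ f] exI[of _ D] conjI allI)
    show "(\<exists>f. D i = f \<and> smooth_closure f) \<or> smooth (D i)" for i
      using D(1)[of i] by blast
  qed (use D smooth in \<open>simp_all add: smooth_closure_continuous\<close>)
qed

lemma smooth_const: "smooth (\<lambda>x. c)"
  by (intro smooth_closure_imp_smooth smooth_closure.const)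

lemma smooth_add: "smooth f \<Longrightarrow> smooth g \<Longrightarrow> smooth (\<lambda>x. f x + g x)"
  by (rule smooth_closure_imp_smooth[OF smooth_closure.add]) (simp_all add: smooth_closure.base)

lemma smooth_mult: "smooth f \<Longrightarrow> smooth g \<Longrightarrow> smooth (\<lambda>x. f x * g x)"
  by (rule smooth_closure_imp_smooth[OF smooth_closure.mult]) (simp_all add: smooth_closure.base)

lemma smooth_exp: "smooth f \<Longrightarrow> smooth (\<lambda>x. exp (f x))"
  by (rule smooth_closure_imp_smooth[OF smooth_closure.exp]) (simp_all add: smooth_closure.base)

lemma smooth_inverse: "smooth f \<Longrightarrow> (\<And>x. f x \<noteq> 0) \<Longrightarrow> smooth (\<lambda>x. inverse (f x))"
  by (rule smooth_closure_imp_smooth[OF smooth_closure.inverse]) (simp_all add: smooth_closure.base)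

lemma smooth_ln: "smooth f \<Longrightarrow> (\<And>x. f x > 0) \<Longrightarrow> smooth (\<lambda>x. ln (f x))"
  by (rule smooth_closure_imp_smooth[OF smooth_closure.ln]) (simp_all add: smooth_closure.base)

lemma smooth_diff: "smooth f \<Longrightarrow> smooth g \<Longrightarrow> smooth (\<lambda>x. f x - g x)"
  using smooth_add[of f "\<lambda>x. (-1) * g x"] smooth_mult[OF smooth_const[of "-1"], of g] by simp

lemma smooth_divide: "smooth f \<Longrightarrow> smooth g \<Longrightarrow> (\<And>x. g x \<noteq> 0) \<Longrightarrow> smooth (\<lambda>x. f x / g x)"
  unfolding divide_inverse by (intro smooth_mult smooth_inverse)

lemma smooth_power2: "smooth f \<Longrightarrow> smooth (\<lambda>x. (f x)\<^sup>2)"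
  using smooth_mult[of f f] by (simp add: power2_eq_square)

lemmas smooth_intros = smooth_const smooth_add smooth_diff smooth_mult smooth_divide smooth_power2
  smooth_exp smooth_ln

text \<open>\<open>deriv\<close> is a choice operator with no meaning where the derivative fails to
  exist. Smoothness supplies a derivative, and uniqueness identifies it with
  \<open>pdiff\<close>.\<close>

lemma smooth_has_pdiff:
  assumes "smooth f"
  shows "((\<lambda>t. f (x + t *\<^sub>R axis i 1)) has_real_derivative pdiff f i x) (at 0)"
proof -
  obtain D where "((\<lambda>t. f (x + t *\<^sub>R axis i 1)) has_real_derivative D i x) (at 0)"
    using smooth_partials[OF assms] by metis
  then show ?thesis
    unfolding pdiff_def by (simp add: DERIV_imp_deriv)
qed

lemma smooth_pdiff:
  assumes "smooth f"
  shows "smooth (pdiff f i)"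
proof -
  obtain D where D: "\<And>x. ((\<lambda>t. f (x + t *\<^sub>R axis i 1)) has_real_derivative D i x) (at 0)"
    "smooth (D i)"
    using smooth_partials[OF assms] by metis
  have "pdiff f i = D i"
    using D(1) unfolding pdiff_def by (auto simp: DERIV_imp_deriv)
  with D show ?thesis by simp
qed

lemma smooth_grad_continuous:
  assumes "smooth f"
  shows "continuous_on UNIV (grad f)"
  unfolding grad_def
  by (intro continuous_on_vec_lambda smooth_continuous smooth_pdiff assms)

lemma smooth_grad_measurable:
  assumes "smooth f"
  shows "grad f \<in> borel_measurable (lebesgue_on \<Omega>)"
  by (intro measurable_restrict_space1 measurable_completion)
    (simp add: borel_measurable_continuous_onI smooth_grad_continuous assms)

lemma smooth_measurable:
  assumes "smooth f"
  shows "f \<in> borel_measurable (lebesgue_on \<Omega>)"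
  by (intro measurable_restrict_space1 measurable_completion)
    (simp add: borel_measurable_continuous_onI smooth_continuous assms)

text \<open>Extending both functions by zero moves the question to the complete measure
  \<open>lebesgue\<close>, where a change on a null set preserves measurability.\<close>

lemma borel_measurable_lebesgue_on_AE:
  fixes f g :: "'a::euclidean_space \<Rightarrow> real"
  assumes S: "S \<in> sets lebesgue"
    and f: "f \<in> borel_measurable (lebesgue_on S)"
    and ae: "AE x in lebesgue_on S. f x = g x"
  shows "g \<in> borel_measurable (lebesgue_on S)"
proof -
  have "(\<lambda>x. if x \<in> S then f x else 0) \<in> borel_measurable lebesgue"
    using f S by (simp add: borel_measurable_if)
  moreover have "AE x in lebesgue. (if x \<in> S then f x else 0) = (if x \<in> S then g x else 0)"
    using ae S by (subst (asm) AE_restrict_space_iff) auto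
  ultimately have "(\<lambda>x. if x \<in> S then g x else 0) \<in> borel_measurable lebesgue"
    by (rule borel_measurable_AE)
  then show ?thesis
    using S by (simp add: borel_measurable_if)
qed

section \<open>Approximation in the Sobolev space\<close>

text \<open>The crude constant comes from \<open>a + b \<le> 2 * max a b\<close>. It is enough to
  make approximation errors integrable and to dominate gradients.\<close>

lemma powr_add_le_two_powr:
  fixes a b r :: real
  assumes "0 \<le> a" "0 \<le> b" "0 \<le> r"
  shows "(a + b) powr r \<le> 2 powr r * (a powr r + b powr r)"
proof -
  have "(a + b) powr r \<le> (2 * max a b) powr r"
    using assms by (intro powr_mono2) auto
  also have "\<dots> = 2 powr r * max a b powr r"
    using assms by (simp add: powr_mult)
  also have "\<dots> \<le> 2 powr r * (a powr r + b powr r)"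
    by (intro mult_left_mono) (auto simp: max_def)
  finally show ?thesis .
qed

lemma powr_tendsto_zeroD:
  fixes f :: "nat \<Rightarrow> real"
  assumes "(\<lambda>k. f k powr r) \<longlonglongrightarrow> 0" "0 < r" "\<And>k. 0 \<le> f k"
  shows "f \<longlonglongrightarrow> 0"
proof -
  have "(\<lambda>k. (f k powr r) powr (1 / r)) \<longlonglongrightarrow> 0 powr (1 / r)"
    using assms by (intro tendsto_powr') auto
  then show ?thesis
    using assms by (simp add: powr_powr)
qed

text \<open>Monotone convergence gives the extended-real sum a finite integral, hence finite values
  almost everywhere.\<close>

lemma integrable_suminf_nonneg:
  fixes e :: "nat \<Rightarrow> 'a \<Rightarrow> real"
  assumes int: "\<And>k. integrable M (e k)" and nn: "\<And>k x. 0 \<le> e k x"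
    and sm: "summable (\<lambda>k. \<integral>x. e k x \<partial>M)"
  shows "AE x in M. summable (\<lambda>k. e k x)" "integrable M (\<lambda>x. \<Sum>k. e k x)"
proof -
  have [measurable]: "e k \<in> borel_measurable M" for k
    using int by auto
  have "(\<integral>\<^sup>+x. (\<Sum>k. ennreal (e k x)) \<partial>M) = (\<Sum>k. ennreal (\<integral>x. e k x \<partial>M))"
    using int nn by (simp add: nn_integral_suminf nn_integral_eq_integral)
  also have "\<dots> = ennreal (\<Sum>k. \<integral>x. e k x \<partial>M)"
    using sm nn by (intro suminf_ennreal2) auto
  finally have "(\<integral>\<^sup>+x. (\<Sum>k. ennreal (e k x)) \<partial>M) \<noteq> \<infinity>"
    by simp
  then have "AE x in M. (\<Sum>k. ennreal (e k x)) \<noteq> \<infinity>"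
    by (intro nn_integral_noteq_infinite) auto
  then show *: "AE x in M. summable (\<lambda>k. e k x)"
    by eventually_elim (use nn in \<open>auto intro!: summable_suminf_not_top\<close>)
  show "integrable M (\<lambda>x. \<Sum>k. e k x)"
    using * nn sm by (intro integrable_suminf int) auto
qed

lemma finite_measure_lebesgue_on_bounded_open:
  fixes \<Omega> :: "'a::euclidean_space set"
  assumes "open \<Omega>" "bounded \<Omega>"
  shows "finite_measure (lebesgue_on \<Omega>)"
  using assms by (intro finite_measure_lebesgue_on) (auto intro: bounded_set_imp_lmeasurable)

lemma continuous_bounded_on_bounded:
  fixes f :: "'a::euclidean_space \<Rightarrow> 'b::real_normed_vector"
  assumes "bounded \<Omega>" "continuous_on UNIV f"
  obtains B where "\<And>x. x \<in> \<Omega> \<Longrightarrow> norm (f x) \<le> B"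
proof -
  have "compact (f ` closure \<Omega>)"
    using assms by (intro compact_continuous_image)
      (auto simp: compact_closure intro: continuous_on_subset)
  then obtain B where "\<forall>y \<in> f ` closure \<Omega>. norm y \<le> B"
    using compact_imp_bounded bounded_iff by metis
  then show thesis
    using closure_subset by (intro that[of B]) blast
qed

lemma integrable_powr_norm_continuous:
  fixes f :: "'a::euclidean_space \<Rightarrow> 'b::euclidean_space"
  assumes "open \<Omega>" "bounded \<Omega>" "continuous_on UNIV f" "0 \<le> r"
  shows "integrable (lebesgue_on \<Omega>) (\<lambda>x. norm (f x) powr r)"
proof -
  interpret finite_measure "lebesgue_on \<Omega>"
    using assms(1,2) by (rule finite_measure_lebesgue_on_bounded_open)
  have [measurable]: "f \<in> borel_measurable (lebesgue_on \<Omega>)"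
    by (intro measurable_restrict_space1 measurable_completion)
      (simp add: borel_measurable_continuous_onI assms)
  obtain B where "\<And>x. x \<in> \<Omega> \<Longrightarrow> norm (f x) \<le> B"
    using continuous_bounded_on_bounded assms(2,3) by blast
  then show ?thesis
    using assms by (intro integrable_const_bound[where B = "B powr r"])
      (auto intro!: AE_I2 powr_mono2)
qed

text \<open>A fast subsequence makes the sum of the error terms \<open>e k\<close> integrable, which yields both pointwise
  convergence and an integrable majorant of the gradients.\<close>
lemma W01_fun_approx:
  fixes \<Omega> :: "(real^'n) set"
  assumes \<Omega>: "open \<Omega>" "bounded \<Omega>" and r: "0 < r" and W: "W01_fun \<Omega> r u G"
  obtains \<phi> D where "\<And>k. test_fun \<Omega> (\<phi> k)" "integrable (lebesgue_on \<Omega>) D"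
    "AE x in lebesgue_on \<Omega>. (\<lambda>k. \<phi> k x) \<longlonglongrightarrow> u x"
    "AE x in lebesgue_on \<Omega>. (\<lambda>k. grad (\<phi> k) x) \<longlonglongrightarrow> G x"
    "AE x in lebesgue_on \<Omega>. \<forall>k. norm (grad (\<phi> k) x) powr r \<le> D x"
    "AE x in lebesgue_on \<Omega>. norm (G x) powr r \<le> D x"
proof -
  let ?M = "lebesgue_on \<Omega>"
  have [measurable]: "u \<in> borel_measurable ?M" "G \<in> borel_measurable ?M"
    and uint: "integrable ?M (\<lambda>x. \<bar>u x\<bar> powr r)"
    and Gint: "integrable ?M (\<lambda>x. norm (G x) powr r)"
    using W unfolding W01_fun_def Lp_fun_def weak_grad_def by auto
  obtain \<phi>0 where t0: "\<And>k. test_fun \<Omega> (\<phi>0 k)"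
    and lim0: "(\<lambda>k. (\<integral>x. \<bar>\<phi>0 k x - u x\<bar> powr r \<partial>?M)
            + (\<integral>x. norm (grad (\<phi>0 k) x - G x) powr r \<partial>?M)) \<longlonglongrightarrow> 0"
    using W unfolding W01_fun_def by auto
  \<comment> \<open>The geometric rate makes the error integrals summable along the selected
    subsequence.\<close>
  have "\<exists>k. (\<integral>x. \<bar>\<phi>0 k x - u x\<bar> powr r \<partial>?M)
            + (\<integral>x. norm (grad (\<phi>0 k) x - G x) powr r \<partial>?M) < (1/2) ^ n" for n
    using order_tendstoD(2)[OF lim0, of "(1/2)^n"] by (auto simp: eventually_sequentially)
  then have "\<forall>n. \<exists>k. (\<integral>x. \<bar>\<phi>0 k x - u x\<bar> powr r \<partial>?M)
            + (\<integral>x. norm (grad (\<phi>0 k) x - G x) powr r \<partial>?M) < (1/2) ^ n" by blast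
  from choice[OF this] obtain s where s: "\<And>n. (\<integral>x. \<bar>\<phi>0 (s n) x - u x\<bar> powr r \<partial>?M)
            + (\<integral>x. norm (grad (\<phi>0 (s n)) x - G x) powr r \<partial>?M) < (1/2) ^ n"
    by blast
  define \<phi> where "\<phi> n = \<phi>0 (s n)" for n
  have t: "test_fun \<Omega> (\<phi> k)" for k
    unfolding \<phi>_def by (rule t0)
  then have sm: "smooth (\<phi> k)" for k
    by (simp add: test_fun_def)
  note [measurable] = smooth_measurable[OF sm] smooth_grad_measurable[OF sm]
  \<comment> \<open>The Bochner integral of a non-integrable function is \<open>0\<close>, so
    smallness of the error integrals carries information only once integrability is established,
    here and in \<open>i2\<close>.\<close>
  have i1: "integrable ?M (\<lambda>x. \<bar>\<phi> k x - u x\<bar> powr r)" for k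
  proof (rule Bochner_Integration.integrable_bound)
    show "integrable ?M (\<lambda>x. 2 powr r * (norm (\<phi> k x) powr r + \<bar>u x\<bar> powr r))"
      using r by (intro integrable_mult_right Bochner_Integration.integrable_add uint
          integrable_powr_norm_continuous \<Omega> smooth_continuous sm) auto
    have "\<bar>\<phi> k x - u x\<bar> powr r \<le> 2 powr r * (norm (\<phi> k x) powr r + \<bar>u x\<bar> powr r)" for x
    proof -
      have "\<bar>\<phi> k x - u x\<bar> powr r \<le> (norm (\<phi> k x) + \<bar>u x\<bar>) powr r"
        using r by (intro powr_mono2) auto
      also have "\<dots> \<le> 2 powr r * (norm (\<phi> k x) powr r + \<bar>u x\<bar> powr r)"
        using r by (intro powr_add_le_two_powr) auto
      finally show ?thesis .
    qed
    then show "AE x in ?M. norm (\<bar>\<phi> k x - u x\<bar> powr r)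
        \<le> norm (2 powr r * (norm (\<phi> k x) powr r + \<bar>u x\<bar> powr r))"
      by (intro AE_I2) (simp add: order_trans[OF _ abs_ge_self])
  qed measurable
  have i2: "integrable ?M (\<lambda>x. norm (grad (\<phi> k) x - G x) powr r)" for k
  proof (rule Bochner_Integration.integrable_bound)
    show "integrable ?M (\<lambda>x. 2 powr r * (norm (grad (\<phi> k) x) powr r + norm (G x) powr r))"
      using r by (intro integrable_mult_right Bochner_Integration.integrable_add Gint
          integrable_powr_norm_continuous \<Omega> smooth_grad_continuous sm) auto
    have "norm (grad (\<phi> k) x - G x) powr r
        \<le> 2 powr r * (norm (grad (\<phi> k) x) powr r + norm (G x) powr r)" for x
    proof -
      have "norm (grad (\<phi> k) x - G x) powr r \<le> (norm (grad (\<phi> k) x) + norm (G x)) powr r"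
        using r by (intro powr_mono2) (auto simp: norm_triangle_ineq4)
      also have "\<dots> \<le> 2 powr r * (norm (grad (\<phi> k) x) powr r + norm (G x) powr r)"
        using r by (intro powr_add_le_two_powr) auto
      finally show ?thesis .
    qed
    then show "AE x in ?M. norm (norm (grad (\<phi> k) x - G x) powr r)
        \<le> norm (2 powr r * (norm (grad (\<phi> k) x) powr r + norm (G x) powr r))"
      by (intro AE_I2) (simp add: order_trans[OF _ abs_ge_self])
  qed measurable
  define e where "e k x = \<bar>\<phi> k x - u x\<bar> powr r + norm (grad (\<phi> k) x - G x) powr r" for k x
  have ie: "integrable ?M (e k)" for k
    unfolding e_def by (intro Bochner_Integration.integrable_add i1 i2)
  have e0: "0 \<le> e k x" for k x
    unfolding e_def by simp
  have "integral\<^sup>L ?M (e k) \<le> (1/2) ^ k" for k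
    using s[of k] Bochner_Integration.integral_add[OF i1[of k] i2[of k]]
    unfolding e_def \<phi>_def by linarith
  moreover have "0 \<le> integral\<^sup>L ?M (e k)" for k
    by (rule Bochner_Integration.integral_nonneg) (rule e0)
  ultimately have "norm (integral\<^sup>L ?M (e k)) \<le> (1/2) ^ k" for k
    unfolding real_norm_def by (metis abs_of_nonneg)
  then have "summable (\<lambda>k. integral\<^sup>L ?M (e k))"
    by (intro summable_comparison_test'[OF summable_geometric[of "1/2 :: real"], of 0]) auto
  note S = integrable_suminf_nonneg[OF ie e0 this]
  \<comment> \<open>The first summand dominates every \<open>grad (\<phi> k)\<close>, by the
    triangle inequality and \<open>e k x \<le> (\<Sum>k. e k x)\<close>. The second one dominates
    \<open>G\<close>.\<close>
  define D where "D x = 2 powr r * (norm (G x) powr r + (\<Sum>k. e k x)) + norm (G x) powr r" for x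
  show thesis
  proof (rule that[of \<phi> D])
    show "integrable ?M D"
      unfolding D_def by (intro Bochner_Integration.integrable_add integrable_mult_right Gint S)
    show "AE x in ?M. (\<lambda>k. \<phi> k x) \<longlonglongrightarrow> u x"
      using S(1)
    proof eventually_elim
      case (elim x)
      then have "(\<lambda>k. e k x) \<longlonglongrightarrow> 0" by (rule summable_LIMSEQ_zero)
      then have "(\<lambda>k. \<bar>\<phi> k x - u x\<bar> powr r) \<longlonglongrightarrow> 0"
        by (rule tendsto_sandwich[OF _ _ tendsto_const, rotated 2]) (auto simp: e_def)
      then have "(\<lambda>k. \<bar>\<phi> k x - u x\<bar>) \<longlonglongrightarrow> 0"
        using r by (rule powr_tendsto_zeroD) auto
      then show ?case
        by (simp add: LIM_zero_iff tendsto_rabs_zero_iff)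
    qed
    show "AE x in ?M. (\<lambda>k. grad (\<phi> k) x) \<longlonglongrightarrow> G x"
      using S(1)
    proof eventually_elim
      case (elim x)
      then have "(\<lambda>k. e k x) \<longlonglongrightarrow> 0" by (rule summable_LIMSEQ_zero)
      then have "(\<lambda>k. norm (grad (\<phi> k) x - G x) powr r) \<longlonglongrightarrow> 0"
        by (rule tendsto_sandwich[OF _ _ tendsto_const, rotated 2]) (auto simp: e_def)
      then have "(\<lambda>k. norm (grad (\<phi> k) x - G x)) \<longlonglongrightarrow> 0"
        using r by (rule powr_tendsto_zeroD) auto
      then show ?case
        by (simp add: LIM_zero_iff tendsto_norm_zero_iff)
    qed
    show "AE x in ?M. \<forall>k. norm (grad (\<phi> k) x) powr r \<le> D x"
      using S(1)
    proof eventually_elim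
      case (elim x)
      show ?case
      proof
        fix k
        have "norm (grad (\<phi> k) x) powr r \<le> (norm (G x) + norm (grad (\<phi> k) x - G x)) powr r"
          using r by (intro powr_mono2) (auto simp: norm_triangle_sub)
        also have "\<dots> \<le> 2 powr r * (norm (G x) powr r + norm (grad (\<phi> k) x - G x) powr r)"
          using r by (intro powr_add_le_two_powr) auto
        also have "norm (grad (\<phi> k) x - G x) powr r \<le> e k x"
          by (simp add: e_def)
        also have "e k x \<le> (\<Sum>k. e k x)"
          using sum_le_suminf[OF elim, of "{k}"] e0 by simp
        finally show "norm (grad (\<phi> k) x) powr r \<le> D x"
          by (simp add: D_def mult_left_mono add_increasing2)
      qed
    qed
    show "AE x in ?M. norm (G x) powr r \<le> D x"
      using S(1)
    proof eventually_elim
      case (elim x)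
      show ?case
        using suminf_nonneg[OF elim e0] by (simp add: D_def)
    qed
  qed (rule t)
qed

section \<open>Composite test functions\<close>

text \<open>Smooth, with values between 0 and 1 and zero at \<open>a = 0\<close>. Inserting a test
  function for \<open>a\<close> produces a factor with compact support, and
  \<open>e \<rightarrow> 0\<close> turns this factor into 1 wherever
  \<open>a \<noteq> 0\<close>.\<close>

definition cutoff :: "real \<Rightarrow> real \<Rightarrow> real" where
  "cutoff e a = a\<^sup>2 / (e\<^sup>2 + a\<^sup>2)"

definition cutoff' :: "real \<Rightarrow> real \<Rightarrow> real" where
  "cutoff' e a = 2 * a * e\<^sup>2 / (e\<^sup>2 + a\<^sup>2)\<^sup>2"

lemma sum_squares_pos: "e > 0 \<Longrightarrow> e\<^sup>2 + a\<^sup>2 > (0::real)"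
  by (simp add: add_pos_nonneg)

lemma cutoff_nonneg [simp]: "0 \<le> cutoff e a"
  by (simp add: cutoff_def)

lemma cutoff_le_1 [simp]: "cutoff e a \<le> 1"
proof (cases "e\<^sup>2 + a\<^sup>2 = 0")
  case False
  then have "0 < e\<^sup>2 + a\<^sup>2"
    by (metis add_nonneg_nonneg order_le_less zero_le_power2)
  then show ?thesis
    by (simp add: cutoff_def)
qed (simp add: cutoff_def)

lemma cutoff_0 [simp]: "cutoff e 0 = 0"
  by (simp add: cutoff_def)

lemma DERIV_cutoff:
  assumes "e > 0"
  shows "(cutoff e has_real_derivative cutoff' e a) (at a)"
  unfolding cutoff_def cutoff'_def
  using sum_squares_pos[OF assms, of a]
  by (auto intro!: derivative_eq_intros simp: power2_eq_square field_simps)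

lemma smooth_cutoff: "e > 0 \<Longrightarrow> smooth f \<Longrightarrow> smooth (\<lambda>x. cutoff e (f x))"
  unfolding cutoff_def
  by (intro smooth_intros) (simp_all add: less_imp_neq[OF sum_squares_pos, symmetric])

lemma cutoff_tendsto:
  "e > 0 \<Longrightarrow> f \<longlonglongrightarrow> a \<Longrightarrow> (\<lambda>k. cutoff e (f k)) \<longlonglongrightarrow> cutoff e a"
  "e > 0 \<Longrightarrow> f \<longlonglongrightarrow> a \<Longrightarrow> (\<lambda>k. cutoff' e (f k)) \<longlonglongrightarrow> cutoff' e a"
  unfolding cutoff_def cutoff'_def
  by (intro tendsto_intros; simp add: less_imp_neq[OF sum_squares_pos, symmetric])+

lemma measurable_cutoff [measurable]:
  assumes [measurable]: "f \<in> borel_measurable M"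
  shows "(\<lambda>x. cutoff e (f x)) \<in> borel_measurable M" "(\<lambda>x. cutoff' e (f x)) \<in> borel_measurable M"
  unfolding cutoff_def cutoff'_def by measurable

text \<open>Combines \<open>2 * e * \<bar>a\<bar> \<le> e^2 + a^2\<close> with
  \<open>e^2 \<le> e^2 + a^2\<close>. The bound serves the limits taken at fixed
  \<open>e\<close>.\<close>

lemma abs_cutoff'_le:
  assumes "e > 0"
  shows "\<bar>cutoff' e a\<bar> \<le> 1 / e"
proof -
  have "e * (2 * \<bar>a\<bar> * e\<^sup>2) = (2 * e * \<bar>a\<bar>) * e\<^sup>2"
    by (simp add: algebra_simps)
  also have "\<dots> \<le> (e\<^sup>2 + a\<^sup>2) * (e\<^sup>2 + a\<^sup>2)"
    using sum_squares_bound[of e "\<bar>a\<bar>"] assms by (intro mult_mono) auto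
  finally have "2 * \<bar>a\<bar> * e\<^sup>2 \<le> (e\<^sup>2 + a\<^sup>2)\<^sup>2 / e"
    using assms by (simp add: field_simps power2_eq_square)
  then have "2 * \<bar>a\<bar> * e\<^sup>2 / (e\<^sup>2 + a\<^sup>2)\<^sup>2 \<le> 1 / e"
    using sum_squares_pos[OF assms, of a] by (subst pos_divide_le_eq) auto
  then show ?thesis
    by (simp add: cutoff'_def abs_mult abs_divide)
qed

text \<open>Unlike \<open>1 / e\<close>, this bound is uniform in \<open>e\<close>. It is what
  controls the derivative of the cutoff as \<open>e \<rightarrow> 0\<close>, provided the other
  factor is at most a multiple of \<open>a\<close>.\<close>

lemma abs_cutoff'_mult_le:
  assumes "e > 0"
  shows "\<bar>cutoff' e a\<bar> * \<bar>a\<bar> \<le> 2"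
proof -
  have "\<bar>a\<bar> * \<bar>a\<bar> * e\<^sup>2 \<le> (e\<^sup>2 + a\<^sup>2) * (e\<^sup>2 + a\<^sup>2)"
    by (intro mult_mono) (auto simp: power2_eq_square)
  then have "2 * (\<bar>a\<bar> * \<bar>a\<bar> * e\<^sup>2) \<le> 2 * (e\<^sup>2 + a\<^sup>2)\<^sup>2"
    by (simp add: power2_eq_square)
  then have "2 * (\<bar>a\<bar> * \<bar>a\<bar> * e\<^sup>2) / (e\<^sup>2 + a\<^sup>2)\<^sup>2 \<le> 2"
    using sum_squares_pos[OF assms, of a] by (subst pos_divide_le_eq) auto
  then show ?thesis
    by (simp add: cutoff'_def abs_mult abs_divide mult_ac)
qed

lemma cutoff_param_tendsto:
  assumes "a \<noteq> 0"
  shows "(\<lambda>n. cutoff (1 / real (Suc n)) a) \<longlonglongrightarrow> 1"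
    "(\<lambda>n. cutoff' (1 / real (Suc n)) a) \<longlonglongrightarrow> 0"
proof -
  have e: "(\<lambda>n. 1 / real (Suc n)) \<longlonglongrightarrow> 0"
    using LIMSEQ_inverse_real_of_nat by (simp add: inverse_eq_divide)
  have "(\<lambda>n. a\<^sup>2 / ((1 / real (Suc n))\<^sup>2 + a\<^sup>2)) \<longlonglongrightarrow> a\<^sup>2 / (0\<^sup>2 + a\<^sup>2)"
    using assms by (intro tendsto_intros e) auto
  then show "(\<lambda>n. cutoff (1 / real (Suc n)) a) \<longlonglongrightarrow> 1"
    using assms by (simp add: cutoff_def)
  have "(\<lambda>n. 2 * a * (1 / real (Suc n))\<^sup>2 / ((1 / real (Suc n))\<^sup>2 + a\<^sup>2)\<^sup>2)
      \<longlonglongrightarrow> 2 * a * 0\<^sup>2 / (0\<^sup>2 + a\<^sup>2)\<^sup>2"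
    using assms by (intro tendsto_intros e) auto
  then show "(\<lambda>n. cutoff' (1 / real (Suc n)) a) \<longlonglongrightarrow> 0"
    by (simp add: cutoff'_def)
qed

text \<open>Dominated convergence on both sides. Integrability of the limits is recorded as well
  because the two weak inequalities are later added under one integral.\<close>

lemma integral_le_dominated_limit_integrable:
  fixes f g :: "nat \<Rightarrow> 'a \<Rightarrow> real"
  assumes le: "\<And>n. integral\<^sup>L M (f n) \<le> integral\<^sup>L M (g n)"
    and m: "\<And>n. f n \<in> borel_measurable M" "f' \<in> borel_measurable M"
      "\<And>n. g n \<in> borel_measurable M" "g' \<in> borel_measurable M"
    and F: "integrable M F" "AE x in M. \<forall>n. \<bar>f n x\<bar> \<le> F x" "AE x in M. (\<lambda>n. f n x) \<longlonglongrightarrow> f' x"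
    and G: "integrable M G" "AE x in M. \<forall>n. \<bar>g n x\<bar> \<le> G x" "AE x in M. (\<lambda>n. g n x) \<longlonglongrightarrow> g' x"
  shows "integral\<^sup>L M f' \<le> integral\<^sup>L M g' \<and> integrable M f' \<and> integrable M g'"
proof -
  have "(\<lambda>n. integral\<^sup>L M (f n)) \<longlonglongrightarrow> integral\<^sup>L M f'"
    using F(2) by (intro integral_dominated_convergence[where w = F] m F(1,3)) (auto elim: eventually_mono)
  moreover have "(\<lambda>n. integral\<^sup>L M (g n)) \<longlonglongrightarrow> integral\<^sup>L M g'"
    using G(2) by (intro integral_dominated_convergence[where w = G] m G(1,3)) (auto elim: eventually_mono)
  ultimately have "integral\<^sup>L M f' \<le> integral\<^sup>L M g'"
    by (rule LIMSEQ_le) (use le in auto)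
  moreover have "integrable M f'"
    using F(2) by (intro integrable_dominated_convergence[OF m(2,1) F(1,3)]) (auto elim: eventually_mono)
  moreover have "integrable M g'"
    using G(2) by (intro integrable_dominated_convergence[OF m(4,3) G(1,3)]) (auto elim: eventually_mono)
  ultimately show ?thesis by blast
qed

lemmas integral_le_dominated_limit = integral_le_dominated_limit_integrable[THEN conjunct1]

text \<open>Cauchy-Schwarz term by term. The three vectors match the three gradients produced by
  differentiating a cutoff times a function of two arguments.\<close>

lemma abs_inner_lincomb_le:
  fixes T X Y Z :: "'a::real_inner"
  assumes "norm T * norm X \<le> D" "norm T * norm Y \<le> D" "norm T * norm Z \<le> D"
    and "\<bar>\<alpha>\<bar> \<le> A" "\<bar>\<beta>\<bar> \<le> B" "\<bar>\<gamma>\<bar> \<le> C"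
  shows "\<bar>T \<bullet> (\<alpha> *\<^sub>R X + \<beta> *\<^sub>R Y + \<gamma> *\<^sub>R Z)\<bar> \<le> (A + B + C) * D"
proof -
  have *: "\<bar>\<kappa> * (T \<bullet> V)\<bar> \<le> K * D" if "norm T * norm V \<le> D" "\<bar>\<kappa>\<bar> \<le> K" for \<kappa> K V
  proof -
    have "\<bar>T \<bullet> V\<bar> \<le> D"
      using Cauchy_Schwarz_ineq2[of T V] that by linarith
    then show ?thesis
      using that by (auto simp: abs_mult intro!: mult_mono)
  qed
  have "\<bar>T \<bullet> (\<alpha> *\<^sub>R X + \<beta> *\<^sub>R Y + \<gamma> *\<^sub>R Z)\<bar>
      \<le> \<bar>\<alpha> * (T \<bullet> X)\<bar> + \<bar>\<beta> * (T \<bullet> Y)\<bar> + \<bar>\<gamma> * (T \<bullet> Z)\<bar>"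
    by (simp add: inner_add_right)
  also have "\<dots> \<le> A * D + B * D + C * D"
    using assms by (intro add_mono *)
  finally show ?thesis by (simp add: algebra_simps)
qed

lemma continuous_Pair_tendsto:
  fixes H :: "real \<Rightarrow> real \<Rightarrow> real"
  assumes "continuous_on UNIV (\<lambda>z. H (fst z) (snd z))" "f \<longlonglongrightarrow> a" "g \<longlonglongrightarrow> b"
  shows "(\<lambda>k. H (f k) (g k)) \<longlonglongrightarrow> H a b"
  using continuous_on_tendsto_compose[OF assms(1) tendsto_Pair[OF assms(2,3)]] by simp

text \<open>The chain rule for \<open>H\<close> is assumed along curves of one real variable, since
  \<open>pdiff\<close> differentiates along axis lines.\<close>

lemma grad_cutoff_mult:
  assumes e: "e > 0" and s: "smooth w" "smooth f" "smooth g"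
    and deriv: "\<And>f g f' g' t. (f has_real_derivative f') (at t) \<Longrightarrow> (g has_real_derivative g') (at t) \<Longrightarrow>
      ((\<lambda>t. H (f t) (g t)) has_real_derivative (Ha (f t) (g t) * f' + Hb (f t) (g t) * g')) (at t)"
  shows "grad (\<lambda>x. cutoff e (w x) * H (f x) (g x)) x =
    (cutoff' e (w x) * H (f x) (g x)) *\<^sub>R grad w x
    + (cutoff e (w x) * Ha (f x) (g x)) *\<^sub>R grad f x + (cutoff e (w x) * Hb (f x) (g x)) *\<^sub>R grad g x"
proof -
  have "pdiff (\<lambda>x. cutoff e (w x) * H (f x) (g x)) i x =
    (cutoff' e (w x) * H (f x) (g x)) * pdiff w i x
    + (cutoff e (w x) * Ha (f x) (g x)) * pdiff f i x + (cutoff e (w x) * Hb (f x) (g x)) * pdiff g i x" for i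
  proof -
    have 1: "((\<lambda>t. cutoff e (w (x + t *\<^sub>R axis i 1))) has_real_derivative cutoff' e (w x) * pdiff w i x) (at 0)"
      using DERIV_chain2[OF DERIV_cutoff[OF e] smooth_has_pdiff[OF s(1)], of x i] by simp
    have 2: "((\<lambda>t. H (f (x + t *\<^sub>R axis i 1)) (g (x + t *\<^sub>R axis i 1))) has_real_derivative
        Ha (f x) (g x) * pdiff f i x + Hb (f x) (g x) * pdiff g i x) (at 0)"
      using deriv[OF smooth_has_pdiff[OF s(2)] smooth_has_pdiff[OF s(3)], of x i] by simp
    show ?thesis
      using DERIV_imp_deriv[OF DERIV_mult[OF 1 2]] unfolding pdiff_def by (simp add: algebra_simps)
  qed
  then show ?thesis
    by (simp add: grad_def vec_eq_iff)
qed

lemma test_fun_smooth: "test_fun \<Omega> p \<Longrightarrow> smooth p"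
  by (simp add: test_fun_def)

text \<open>Since \<open>cutoff e 0 = 0\<close>, the product vanishes wherever \<open>w\<close> does
  and inherits its compact support, whatever the support of \<open>f\<close> is.\<close>

lemma test_fun_cutoff_mult:
  assumes "e > 0" "test_fun \<Omega> w" "smooth f"
  shows "test_fun \<Omega> (\<lambda>x. cutoff e (w x) * f x)"
proof -
  obtain K where "compact K" "K \<subseteq> \<Omega>" "\<forall>x. x \<notin> K \<longrightarrow> w x = 0"
    using assms(2) unfolding test_fun_def by blast
  then show ?thesis
    using assms unfolding test_fun_def by (intro conjI smooth_mult smooth_cutoff exI[of _ K]) auto
qed

text \<open>Used with \<open>T = |U| powr (r - 2) U\<close>, and with \<open>T = - |V| powr (r - 2) V\<close> and \<open>h\<close> negated, so that both
  differential inequalities take the same form.\<close>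
locale weak_inequality =
  fixes \<Omega> :: "(real^'n) set" and \<phi> \<psi> :: "nat \<Rightarrow> real^'n \<Rightarrow> real" and u v h D :: "real^'n \<Rightarrow> real"
    and U V T :: "real^'n \<Rightarrow> real^'n"
  assumes \<phi>: "\<And>k. test_fun \<Omega> (\<phi> k)" and \<psi>: "\<And>k. test_fun \<Omega> (\<psi> k)"
    and meas [measurable]: "u \<in> borel_measurable (lebesgue_on \<Omega>)" "v \<in> borel_measurable (lebesgue_on \<Omega>)"
      "U \<in> borel_measurable (lebesgue_on \<Omega>)" "V \<in> borel_measurable (lebesgue_on \<Omega>)"
      "T \<in> borel_measurable (lebesgue_on \<Omega>)" "h \<in> borel_measurable (lebesgue_on \<Omega>)"
    and lim: "AE x in lebesgue_on \<Omega>. (\<lambda>k. \<phi> k x) \<longlonglongrightarrow> u x"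
      "AE x in lebesgue_on \<Omega>. (\<lambda>k. \<psi> k x) \<longlonglongrightarrow> v x"
      "AE x in lebesgue_on \<Omega>. (\<lambda>k. grad (\<phi> k) x) \<longlonglongrightarrow> U x"
      "AE x in lebesgue_on \<Omega>. (\<lambda>k. grad (\<psi> k) x) \<longlonglongrightarrow> V x"
    and D: "integrable (lebesgue_on \<Omega>) D"
      "AE x in lebesgue_on \<Omega>. \<forall>k. norm (T x) * norm (grad (\<phi> k) x) \<le> D x"
      "AE x in lebesgue_on \<Omega>. \<forall>k. norm (T x) * norm (grad (\<psi> k) x) \<le> D x"
      "AE x in lebesgue_on \<Omega>. norm (T x) * norm (U x) \<le> D x"
      "AE x in lebesgue_on \<Omega>. norm (T x) * norm (V x) \<le> D x"
    and test: "\<And>p. test_fun \<Omega> p \<Longrightarrow> (\<And>x. 0 \<le> p x) \<Longrightarrow> integrable (lebesgue_on \<Omega>) (\<lambda>x. h x * p x)"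
      "\<And>p. test_fun \<Omega> p \<Longrightarrow> (\<And>x. 0 \<le> p x) \<Longrightarrow>
        (\<integral>x. T x \<bullet> grad p x \<partial>lebesgue_on \<Omega>) \<le> (\<integral>x. h x * p x \<partial>lebesgue_on \<Omega>)"
    and upos: "AE x in lebesgue_on \<Omega>. 0 < u x"
begin

text \<open>\<open>B\<close> together with \<open>D\<close> dominates the gradient side. The bound
  \<open>H (u x) (v x) \<le> B * u x\<close> absorbs the blow-up of \<open>cutoff'\<close> as
  \<open>e \<rightarrow> 0\<close>, and \<open>E\<close> dominates the reaction side once the
  compact support is lost.\<close>

lemma weak_inequality_composition:
  fixes H Ha Hb :: "real \<Rightarrow> real \<Rightarrow> real"
  assumes H_smooth: "\<And>f g :: real^'n \<Rightarrow> real. smooth f \<Longrightarrow> smooth g \<Longrightarrow> smooth (\<lambda>x. H (f x) (g x))"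
    and deriv: "\<And>f g f' g' t. (f has_real_derivative f') (at t) \<Longrightarrow> (g has_real_derivative g') (at t) \<Longrightarrow>
      ((\<lambda>t. H (f t) (g t)) has_real_derivative (Ha (f t) (g t) * f' + Hb (f t) (g t) * g')) (at t)"
    and cont: "continuous_on UNIV (\<lambda>z. H (fst z) (snd z))" "continuous_on UNIV (\<lambda>z. Ha (fst z) (snd z))"
      "continuous_on UNIV (\<lambda>z. Hb (fst z) (snd z))"
    and nn: "\<And>a b. 0 \<le> H a b"
    and B: "\<And>a b. \<bar>H a b\<bar> \<le> B" "\<And>a b. \<bar>Ha a b\<bar> \<le> B" "\<And>a b. \<bar>Hb a b\<bar> \<le> B"
    and Hu: "AE x in lebesgue_on \<Omega>. H (u x) (v x) \<le> B * u x"
    and E: "integrable (lebesgue_on \<Omega>) E" "AE x in lebesgue_on \<Omega>. \<bar>h x\<bar> * H (u x) (v x) \<le> E x"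
  shows "(\<integral>x. T x \<bullet> (Ha (u x) (v x) *\<^sub>R U x + Hb (u x) (v x) *\<^sub>R V x) \<partial>lebesgue_on \<Omega>)
    \<le> (\<integral>x. h x * H (u x) (v x) \<partial>lebesgue_on \<Omega>)"
proof -
  let ?M = "lebesgue_on \<Omega>"
  note s\<phi> = test_fun_smooth[OF \<phi>] and s\<psi> = test_fun_smooth[OF \<psi>]
  note [measurable] = smooth_measurable[OF s\<phi>] smooth_grad_measurable[OF s\<phi>]
    smooth_measurable[OF s\<psi>] smooth_grad_measurable[OF s\<psi>]
    borel_measurable_continuous_Pair[OF _ _ cont(1)] borel_measurable_continuous_Pair[OF _ _ cont(2)]
    borel_measurable_continuous_Pair[OF _ _ cont(3)]
  have B0: "0 \<le> B" using B(1)[of 0 0] by linarith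
  have mult_le_B: "\<bar>cutoff e a * y\<bar> \<le> B" if "\<bar>y\<bar> \<le> B" for e a y
  proof -
    have "\<bar>cutoff e a * y\<bar> \<le> 1 * B"
      unfolding abs_mult using that by (intro mult_mono) auto
    then show ?thesis by simp
  qed
  have mult_le_eB: "\<bar>cutoff' e a * y\<bar> \<le> 1 / e * B" if "\<bar>y\<bar> \<le> B" "e > 0" for e a y
    unfolding abs_mult using that by (intro mult_mono abs_cutoff'_le) auto
  \<comment> \<open>First limit: \<open>k \<rightarrow> \<infinity>\<close> in the arguments of
    \<open>H\<close>, with the support held fixed by \<open>\<phi> j\<close>.\<close>
  have step1: "(\<integral>x. T x \<bullet> ((cutoff' e (\<phi> j x) * H (u x) (v x)) *\<^sub>R grad (\<phi> j) x
      + (cutoff e (\<phi> j x) * Ha (u x) (v x)) *\<^sub>R U x + (cutoff e (\<phi> j x) * Hb (u x) (v x)) *\<^sub>R V x) \<partial>?M)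
    \<le> (\<integral>x. h x * (cutoff e (\<phi> j x) * H (u x) (v x)) \<partial>?M)" if e: "e > 0" for e j
  proof (rule integral_le_dominated_limit)
    fix k
    let ?p = "\<lambda>x. cutoff e (\<phi> j x) * H (\<phi> k x) (\<psi> k x)"
    have t: "test_fun \<Omega> ?p"
      by (intro test_fun_cutoff_mult e \<phi> H_smooth s\<phi> s\<psi>)
    show "(\<integral>x. T x \<bullet> ((cutoff' e (\<phi> j x) * H (\<phi> k x) (\<psi> k x)) *\<^sub>R grad (\<phi> j) x
      + (cutoff e (\<phi> j x) * Ha (\<phi> k x) (\<psi> k x)) *\<^sub>R grad (\<phi> k) x
      + (cutoff e (\<phi> j x) * Hb (\<phi> k x) (\<psi> k x)) *\<^sub>R grad (\<psi> k) x) \<partial>?M)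
      \<le> (\<integral>x. h x * ?p x \<partial>?M)"
    proof (subst grad_cutoff_mult[of e "\<phi> j" "\<phi> k" "\<psi> k" H Ha Hb, symmetric])
      show "(\<integral>x. T x \<bullet> grad ?p x \<partial>?M) \<le> (\<integral>x. h x * ?p x \<partial>?M)"
        using test(2)[OF t] nn by simp
    qed (use e s\<phi> s\<psi> deriv in auto)
  next
    show "integrable ?M (\<lambda>x. (1 / e * B + B + B) * D x)"
      using D(1) by simp
    show "AE x in ?M. \<forall>k. \<bar>T x \<bullet> ((cutoff' e (\<phi> j x) * H (\<phi> k x) (\<psi> k x)) *\<^sub>R grad (\<phi> j) x
      + (cutoff e (\<phi> j x) * Ha (\<phi> k x) (\<psi> k x)) *\<^sub>R grad (\<phi> k) x
      + (cutoff e (\<phi> j x) * Hb (\<phi> k x) (\<psi> k x)) *\<^sub>R grad (\<psi> k) x)\<bar> \<le> (1 / e * B + B + B) * D x"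
      using D(2,3) by eventually_elim (intro allI abs_inner_lincomb_le mult_le_B mult_le_eB B e; blast)
    show "AE x in ?M. (\<lambda>k. T x \<bullet> ((cutoff' e (\<phi> j x) * H (\<phi> k x) (\<psi> k x)) *\<^sub>R grad (\<phi> j) x
      + (cutoff e (\<phi> j x) * Ha (\<phi> k x) (\<psi> k x)) *\<^sub>R grad (\<phi> k) x
      + (cutoff e (\<phi> j x) * Hb (\<phi> k x) (\<psi> k x)) *\<^sub>R grad (\<psi> k) x)) \<longlonglongrightarrow>
      T x \<bullet> ((cutoff' e (\<phi> j x) * H (u x) (v x)) *\<^sub>R grad (\<phi> j) x
      + (cutoff e (\<phi> j x) * Ha (u x) (v x)) *\<^sub>R U x + (cutoff e (\<phi> j x) * Hb (u x) (v x)) *\<^sub>R V x)"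
      using lim by eventually_elim
        (intro tendsto_intros continuous_Pair_tendsto[OF cont(1)] continuous_Pair_tendsto[OF cont(2)]
          continuous_Pair_tendsto[OF cont(3)])
    \<comment> \<open>With the constant \<open>1\<close> as smooth factor,
      \<open>cutoff e (\<phi> j x)\<close> is itself an admissible test function. This gives an
      integrable majorant of the reaction side that does not depend on \<open>k\<close>.\<close>
    have "integrable ?M (\<lambda>x. h x * (cutoff e (\<phi> j x) * 1))"
      by (intro test test_fun_cutoff_mult e \<phi> smooth_const) simp
    then show "integrable ?M (\<lambda>x. B * \<bar>h x * cutoff e (\<phi> j x)\<bar>)"
      by simp
    show "AE x in ?M. \<forall>k. \<bar>h x * (cutoff e (\<phi> j x) * H (\<phi> k x) (\<psi> k x))\<bar> \<le> B * \<bar>h x * cutoff e (\<phi> j x)\<bar>"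
    proof (intro AE_I2 allI)
      fix x k
      have "\<bar>h x * cutoff e (\<phi> j x)\<bar> * \<bar>H (\<phi> k x) (\<psi> k x)\<bar> \<le> \<bar>h x * cutoff e (\<phi> j x)\<bar> * B"
        by (intro mult_left_mono B) simp
      then show "\<bar>h x * (cutoff e (\<phi> j x) * H (\<phi> k x) (\<psi> k x))\<bar> \<le> B * \<bar>h x * cutoff e (\<phi> j x)\<bar>"
        by (simp add: abs_mult mult_ac)
    qed
    show "AE x in ?M. (\<lambda>k. h x * (cutoff e (\<phi> j x) * H (\<phi> k x) (\<psi> k x))) \<longlonglongrightarrow>
      h x * (cutoff e (\<phi> j x) * H (u x) (v x))"
      using lim(1,2) by eventually_elim (intro tendsto_intros continuous_Pair_tendsto[OF cont(1)])
  qed measurable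
  \<comment> \<open>Second limit: \<open>j \<rightarrow> \<infinity>\<close> in the cutoff. The
    majorant of the reaction side is now \<open>E\<close>, because no fixed compact support
    remains.\<close>
  have step2: "(\<integral>x. T x \<bullet> ((cutoff' e (u x) * H (u x) (v x)) *\<^sub>R U x
      + (cutoff e (u x) * Ha (u x) (v x)) *\<^sub>R U x + (cutoff e (u x) * Hb (u x) (v x)) *\<^sub>R V x) \<partial>?M)
    \<le> (\<integral>x. h x * (cutoff e (u x) * H (u x) (v x)) \<partial>?M)" if e: "e > 0" for e
  proof (rule integral_le_dominated_limit[OF step1[OF e]])
    show "integrable ?M (\<lambda>x. (1 / e * B + B + B) * D x)"
      using D(1) by simp
    show "AE x in ?M. \<forall>j. \<bar>T x \<bullet> ((cutoff' e (\<phi> j x) * H (u x) (v x)) *\<^sub>R grad (\<phi> j) x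
      + (cutoff e (\<phi> j x) * Ha (u x) (v x)) *\<^sub>R U x
      + (cutoff e (\<phi> j x) * Hb (u x) (v x)) *\<^sub>R V x)\<bar> \<le> (1 / e * B + B + B) * D x"
      using D(2,4,5) by eventually_elim (intro allI abs_inner_lincomb_le mult_le_B mult_le_eB B e; blast)
    show "AE x in ?M. (\<lambda>j. T x \<bullet> ((cutoff' e (\<phi> j x) * H (u x) (v x)) *\<^sub>R grad (\<phi> j) x
      + (cutoff e (\<phi> j x) * Ha (u x) (v x)) *\<^sub>R U x
      + (cutoff e (\<phi> j x) * Hb (u x) (v x)) *\<^sub>R V x)) \<longlonglongrightarrow>
      T x \<bullet> ((cutoff' e (u x) * H (u x) (v x)) *\<^sub>R U x
      + (cutoff e (u x) * Ha (u x) (v x)) *\<^sub>R U x + (cutoff e (u x) * Hb (u x) (v x)) *\<^sub>R V x)"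
      using lim by eventually_elim (intro tendsto_intros cutoff_tendsto e)
    show "integrable ?M E" by (rule E)
    show "AE x in ?M. \<forall>j. \<bar>h x * (cutoff e (\<phi> j x) * H (u x) (v x))\<bar> \<le> E x"
      using E(2)
    proof eventually_elim
      case (elim x)
      have "\<bar>h x\<bar> * H (u x) (v x) * cutoff e (\<phi> j x) \<le> \<bar>h x\<bar> * H (u x) (v x)" for j
        using nn by (intro mult_right_le_one_le) auto
      with elim nn show ?case
        by (auto simp: abs_mult mult_ac intro: order_trans)
    qed
    show "AE x in ?M. (\<lambda>j. h x * (cutoff e (\<phi> j x) * H (u x) (v x))) \<longlonglongrightarrow>
      h x * (cutoff e (u x) * H (u x) (v x))"
      using lim(1) by eventually_elim (intro tendsto_intros cutoff_tendsto e)
  qed measurable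
  \<comment> \<open>Third limit: \<open>e = 1 / Suc n \<rightarrow> 0\<close>. The cutoff tends to 1
    and its derivative to 0 wherever \<open>u\<close> is positive; the term
    \<open>0 *\<^sub>R U x\<close> is the limit of the derivative term.\<close>
  have "(\<integral>x. T x \<bullet> (0 *\<^sub>R U x + (1 * Ha (u x) (v x)) *\<^sub>R U x + (1 * Hb (u x) (v x)) *\<^sub>R V x) \<partial>?M)
    \<le> (\<integral>x. h x * (1 * H (u x) (v x)) \<partial>?M)"
  proof (rule integral_le_dominated_limit[OF step2])
    fix n
    show "0 < 1 / real (Suc n)" by simp
  next
    show "integrable ?M (\<lambda>x. (2 * B + B + B) * D x)"
      using D(1) by simp
    show "AE x in ?M. \<forall>n. \<bar>T x \<bullet> ((cutoff' (1 / real (Suc n)) (u x) * H (u x) (v x)) *\<^sub>R U x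
      + (cutoff (1 / real (Suc n)) (u x) * Ha (u x) (v x)) *\<^sub>R U x
      + (cutoff (1 / real (Suc n)) (u x) * Hb (u x) (v x)) *\<^sub>R V x)\<bar> \<le> (2 * B + B + B) * D x"
      using D(4,5) Hu upos
    proof eventually_elim
      case (elim x)
      have "\<bar>cutoff' (1 / real (Suc n)) (u x) * H (u x) (v x)\<bar> \<le> 2 * B" for n
      proof -
        have "\<bar>cutoff' (1 / real (Suc n)) (u x) * H (u x) (v x)\<bar>
            \<le> \<bar>cutoff' (1 / real (Suc n)) (u x)\<bar> * (B * u x)"
          using elim nn[of "u x" "v x"] by (auto simp: abs_mult intro!: mult_left_mono)
        also have "\<dots> = B * (\<bar>cutoff' (1 / real (Suc n)) (u x)\<bar> * \<bar>u x\<bar>)"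
          using elim by simp
        also have "\<dots> \<le> B * 2"
          by (intro mult_left_mono abs_cutoff'_mult_le B0) simp
        finally show ?thesis by simp
      qed
      then show ?case
        using elim by (intro allI abs_inner_lincomb_le mult_le_B B) auto
    qed
    show "AE x in ?M. (\<lambda>n. T x \<bullet> ((cutoff' (1 / real (Suc n)) (u x) * H (u x) (v x)) *\<^sub>R U x
      + (cutoff (1 / real (Suc n)) (u x) * Ha (u x) (v x)) *\<^sub>R U x
      + (cutoff (1 / real (Suc n)) (u x) * Hb (u x) (v x)) *\<^sub>R V x)) \<longlonglongrightarrow>
      T x \<bullet> (0 *\<^sub>R U x + (1 * Ha (u x) (v x)) *\<^sub>R U x + (1 * Hb (u x) (v x)) *\<^sub>R V x)"
      using upos
    proof eventually_elim
      case (elim x)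
      then have "u x \<noteq> 0" by simp
      note cutoff_param_tendsto(1)[OF this] tendsto_mult_left_zero[OF cutoff_param_tendsto(2)[OF this]]
      then show ?case
        by (intro tendsto_intros)
    qed
    show "integrable ?M E" by (rule E)
    show "AE x in ?M. \<forall>n. \<bar>h x * (cutoff (1 / real (Suc n)) (u x) * H (u x) (v x))\<bar> \<le> E x"
      using E(2)
    proof eventually_elim
      case (elim x)
      have "\<bar>h x\<bar> * H (u x) (v x) * cutoff (1 / real (Suc n)) (u x) \<le> \<bar>h x\<bar> * H (u x) (v x)" for n
        using nn by (intro mult_right_le_one_le) auto
      with elim nn show ?case
        by (auto simp: abs_mult mult_ac intro: order_trans)
    qed
    show "AE x in ?M. (\<lambda>n. h x * (cutoff (1 / real (Suc n)) (u x) * H (u x) (v x))) \<longlonglongrightarrow>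
      h x * (1 * H (u x) (v x))"
      using upos by eventually_elim (intro tendsto_intros cutoff_param_tendsto; simp)
  qed measurable
  then show ?thesis by simp
qed

end

section \<open>Regularised logarithm\<close>

text \<open>A bounded smooth approximation of \<open>ln a\<close>; the second logarithm truncates large values of \<open>a\<close>.\<close>
definition reg_ln :: "real \<Rightarrow> real \<Rightarrow> real" where
  "reg_ln e a = (ln (e\<^sup>2 + a\<^sup>2) - ln (1 + e\<^sup>2 * a\<^sup>2)) / 2"

definition reg_ln' :: "real \<Rightarrow> real \<Rightarrow> real" where
  "reg_ln' e a = a / (e\<^sup>2 + a\<^sup>2) - e\<^sup>2 * a / (1 + e\<^sup>2 * a\<^sup>2)"

text \<open>Decreasing in \<open>x\<close>, contrary to the usual convention. At
  \<open>x = m * (ln b - ln a)\<close> it equals \<open>1 / (1 + (b / a) powr m)\<close>, a smooth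
  substitute for the indicator of \<open>b < a\<close>.\<close>

definition logistic :: "real \<Rightarrow> real" where
  "logistic x = 1 / (1 + exp x)"

lemma one_plus_pos: "1 + e\<^sup>2 * a\<^sup>2 > (0::real)"
  by (simp add: add_pos_nonneg)

lemma one_plus_exp_neq_0: "1 + exp x \<noteq> (0::real)"
  using exp_gt_zero[of x] by linarith

lemmas nonzero = less_imp_neq[OF sum_squares_pos, symmetric] less_imp_neq[OF one_plus_pos, symmetric]
  one_plus_exp_neq_0

lemma logistic_bounds: "0 < logistic x" "logistic x < 1"
  by (simp_all add: logistic_def add_pos_pos)

lemma DERIV_reg_ln:
  assumes "e > 0" "(f has_real_derivative f') (at t)"
  shows "((\<lambda>t. reg_ln e (f t)) has_real_derivative reg_ln' e (f t) * f') (at t)"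
proof -
  have 1: "((\<lambda>t. ln (e\<^sup>2 + (f t)\<^sup>2)) has_real_derivative 2 * (f t * f' / (e\<^sup>2 + (f t)\<^sup>2))) (at t)"
    using assms sum_squares_pos[OF assms(1), of "f t"] by (auto intro!: derivative_eq_intros)
  have 2: "((\<lambda>t. ln (1 + e\<^sup>2 * (f t)\<^sup>2)) has_real_derivative
      2 * (e\<^sup>2 * (f t * f') / (1 + e\<^sup>2 * (f t)\<^sup>2))) (at t)"
    using assms one_plus_pos[of e "f t"] by (auto intro!: derivative_eq_intros)
  have "((\<lambda>t. reg_ln e (f t)) has_real_derivative
      (2 * (f t * f' / (e\<^sup>2 + (f t)\<^sup>2)) - 2 * (e\<^sup>2 * (f t * f') / (1 + e\<^sup>2 * (f t)\<^sup>2))) / 2) (at t)"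
    unfolding reg_ln_def by (intro DERIV_cdivide DERIV_diff 1 2)
  also have "(2 * (f t * f' / (e\<^sup>2 + (f t)\<^sup>2)) - 2 * (e\<^sup>2 * (f t * f') / (1 + e\<^sup>2 * (f t)\<^sup>2))) / 2
      = reg_ln' e (f t) * f'"
    unfolding right_diff_distrib[symmetric] reg_ln'_def left_diff_distrib
    by (simp add: mult_ac)
  finally show ?thesis .
qed

text \<open>The logistic differential equation: the derivative is a bounded multiple of the function
  itself, so it can be absorbed into a logarithmic derivative of the test function.\<close>

lemma DERIV_logistic:
  assumes "(f has_real_derivative f') (at t)"
  shows "((\<lambda>t. logistic (f t)) has_real_derivative - logistic (f t) * (1 - logistic (f t)) * f') (at t)"
proof -
  have "((\<lambda>t. 1 / (1 + exp (f t))) has_real_derivative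
      - (exp (f t) * f') / (1 + exp (f t))\<^sup>2) (at t)"
    using assms one_plus_exp_neq_0[of "f t"]
    by (auto intro!: derivative_eq_intros simp: power2_eq_square)
  moreover have "1 - logistic (f t) = exp (f t) / (1 + exp (f t))"
    using one_plus_exp_neq_0[of "f t"] by (simp add: logistic_def field_simps)
  ultimately show ?thesis
    by (simp add: logistic_def power2_eq_square)
qed

lemma smooth_reg_ln: "e > 0 \<Longrightarrow> smooth f \<Longrightarrow> smooth (\<lambda>x. reg_ln e (f x))"
  unfolding reg_ln_def by (intro smooth_intros) (auto simp: sum_squares_pos one_plus_pos)

lemma smooth_logistic: "smooth f \<Longrightarrow> smooth (\<lambda>x. logistic (f x))"
  unfolding logistic_def by (intro smooth_intros) (auto simp: one_plus_exp_neq_0)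

lemma continuous_on_reg [continuous_intros]:
  fixes f :: "'a::t2_space \<Rightarrow> real"
  assumes "continuous_on S f"
  shows "e > 0 \<Longrightarrow> continuous_on S (\<lambda>x. reg_ln e (f x))" "e > 0 \<Longrightarrow> continuous_on S (\<lambda>x. reg_ln' e (f x))"
    "continuous_on S (\<lambda>x. logistic (f x))"
    "e > 0 \<Longrightarrow> continuous_on S (\<lambda>x. cutoff e (f x))" "e > 0 \<Longrightarrow> continuous_on S (\<lambda>x. cutoff' e (f x))"
  unfolding reg_ln_def reg_ln'_def logistic_def cutoff_def cutoff'_def
  by (intro continuous_intros assms; simp add: nonzero)+

lemma reg_ln_le: "e > 0 \<Longrightarrow> reg_ln e a \<le> ln (e\<^sup>2 + a\<^sup>2) / 2"
  by (simp add: reg_ln_def)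

text \<open>Since \<open>e^4 \<le> 1\<close>, the quotient
  \<open>(e^2 + a^2) / (1 + e^2 * a^2)\<close> lies between \<open>e^2\<close> and
  \<open>1 / e^2\<close>; \<open>reg_ln\<close> is half its logarithm.\<close>

lemma abs_reg_ln_le:
  assumes "0 < e" "e \<le> 1"
  shows "\<bar>reg_ln e a\<bar> \<le> - ln e"
proof -
  have e4: "e\<^sup>2 * e\<^sup>2 \<le> 1"
    using assms by (simp add: power_le_one mult_le_one)
  have "e\<^sup>2 * (1 + e\<^sup>2 * a\<^sup>2) \<le> e\<^sup>2 + a\<^sup>2"
    using mult_right_mono[OF e4, of "a\<^sup>2"] by (simp add: algebra_simps)
  then have "ln (e\<^sup>2 * (1 + e\<^sup>2 * a\<^sup>2)) \<le> ln (e\<^sup>2 + a\<^sup>2)"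
    using assms by (subst ln_le_cancel_iff) (auto simp: one_plus_pos sum_squares_pos)
  then have 1: "2 * ln e + ln (1 + e\<^sup>2 * a\<^sup>2) \<le> ln (e\<^sup>2 + a\<^sup>2)"
    using assms one_plus_pos[of e a] by (simp add: ln_mult ln_realpow)
  have "e\<^sup>2 * (e\<^sup>2 + a\<^sup>2) \<le> 1 + e\<^sup>2 * a\<^sup>2"
    using e4 by (simp add: algebra_simps)
  then have "ln (e\<^sup>2 * (e\<^sup>2 + a\<^sup>2)) \<le> ln (1 + e\<^sup>2 * a\<^sup>2)"
    using assms by (subst ln_le_cancel_iff) (auto simp: one_plus_pos sum_squares_pos)
  then have "2 * ln e + ln (e\<^sup>2 + a\<^sup>2) \<le> ln (1 + e\<^sup>2 * a\<^sup>2)"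
    using assms sum_squares_pos[OF assms(1), of a] by (simp add: ln_mult ln_realpow)
  with 1 show ?thesis
    by (simp add: reg_ln_def abs_le_iff field_simps)
qed

lemma abs_reg_ln'_le:
  assumes "0 < e" "e \<le> 1"
  shows "\<bar>reg_ln' e a\<bar> \<le> 2 / e"
proof -
  have "2 * (\<bar>a\<bar> * e) \<le> e\<^sup>2 + a\<^sup>2"
    using sum_squares_bound[of "\<bar>a\<bar>" e] by (simp add: mult_ac add.commute)
  moreover have "0 \<le> \<bar>a\<bar> * e"
    using assms by simp
  ultimately have "\<bar>a\<bar> * e \<le> e\<^sup>2 + a\<^sup>2"
    by linarith
  then have 1: "\<bar>a\<bar> / (e\<^sup>2 + a\<^sup>2) \<le> 1 / e"
    using assms sum_squares_pos[OF assms(1), of a] by (simp add: divide_simps)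
  have "e * (e * \<bar>a\<bar>) \<le> 1 * (1 + e\<^sup>2 * a\<^sup>2)"
  proof (rule mult_mono)
    show "e * \<bar>a\<bar> \<le> 1 + e\<^sup>2 * a\<^sup>2"
    proof -
      have "2 * (e * \<bar>a\<bar>) \<le> 1 + e\<^sup>2 * a\<^sup>2"
        using sum_squares_bound[of "e * \<bar>a\<bar>" 1] by (simp add: power_mult_distrib)
      moreover have "0 \<le> e * \<bar>a\<bar>"
        using assms by simp
      ultimately show ?thesis by linarith
    qed
  qed (use assms in auto)
  moreover have "e * (e * (e * \<bar>a\<bar>)) \<le> e * (e * \<bar>a\<bar>)"
    using assms by (intro mult_left_le_one_le) auto
  moreover have "e * (e * (e * \<bar>a\<bar>)) = e * (e\<^sup>2 * \<bar>a\<bar>)"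
    by (simp add: power2_eq_square)
  ultimately have "e * (e\<^sup>2 * \<bar>a\<bar>) \<le> 1 + e\<^sup>2 * a\<^sup>2"
    by (metis mult_1 order_trans)
  then have 2: "e\<^sup>2 * \<bar>a\<bar> / (1 + e\<^sup>2 * a\<^sup>2) \<le> 1 / e"
    using assms one_plus_pos[of e a] by (simp add: divide_simps mult_ac)
  have "\<bar>reg_ln' e a\<bar> \<le> \<bar>a\<bar> / (e\<^sup>2 + a\<^sup>2) + e\<^sup>2 * \<bar>a\<bar> / (1 + e\<^sup>2 * a\<^sup>2)"
    unfolding reg_ln'_def using abs_triangle_ineq4[of "a / (e\<^sup>2 + a\<^sup>2)" "e\<^sup>2 * a / (1 + e\<^sup>2 * a\<^sup>2)"]
      sum_squares_pos[OF assms(1), of a] one_plus_pos[of e a]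
    by (simp add: abs_mult)
  with 1 2 show ?thesis by simp
qed

text \<open>The product \<open>reg_ln' e a * a\<close> is a difference of two numbers in the unit
  interval. Hence \<open>reg_ln'\<close> is bounded by \<open>1 / a\<close>, the derivative of
  \<open>ln\<close>, uniformly in \<open>e\<close>.\<close>

lemma abs_reg_ln'_mult_le:
  assumes "0 < e" "0 < a"
  shows "\<bar>reg_ln' e a\<bar> * a \<le> 1"
proof -
  have "a\<^sup>2 / (e\<^sup>2 + a\<^sup>2) \<le> 1" "e\<^sup>2 * a\<^sup>2 / (1 + e\<^sup>2 * a\<^sup>2) \<le> 1"
    "0 \<le> a\<^sup>2 / (e\<^sup>2 + a\<^sup>2)" "0 \<le> e\<^sup>2 * a\<^sup>2 / (1 + e\<^sup>2 * a\<^sup>2)"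
    using sum_squares_pos[OF assms(1), of a] one_plus_pos[of e a] by auto
  moreover have "reg_ln' e a * a = a\<^sup>2 / (e\<^sup>2 + a\<^sup>2) - e\<^sup>2 * a\<^sup>2 / (1 + e\<^sup>2 * a\<^sup>2)"
    by (simp add: reg_ln'_def left_diff_distrib power2_eq_square)
  ultimately have "\<bar>reg_ln' e a * a\<bar> \<le> 1" by linarith
  with assms show ?thesis by (simp add: abs_mult)
qed

text \<open>As \<open>K^2 \<ge> 1\<close>, the constant \<open>c\<close> is absorbed:
  \<open>c + d * b^2 \<le> K^2 * (c + d * a^2)\<close>. The choices \<open>(c, d) = (e^2, 1)\<close>
  and \<open>(c, d) = (1, e^2)\<close> cover both logarithms in \<open>reg_ln\<close>.\<close>

lemma ln_affine_square_diff_le: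
  fixes a b c d K :: real
  assumes c: "c > 0" "d \<ge> 0" and "0 < a" "0 < b" "1 \<le> K" "b \<le> K * a"
  shows "ln (c + d * b\<^sup>2) - ln (c + d * a\<^sup>2) \<le> 2 * ln K"
proof -
  have K2: "1 \<le> K\<^sup>2" using assms by (simp add: one_le_power)
  have "b\<^sup>2 \<le> (K * a)\<^sup>2"
    using assms by (intro power_mono) auto
  then have "c + d * b\<^sup>2 \<le> K\<^sup>2 * c + d * (K\<^sup>2 * a\<^sup>2)"
    using c K2 by (intro add_mono mult_left_mono) (auto simp: power_mult_distrib mult_le_cancel_right1)
  also have "\<dots> = K\<^sup>2 * (c + d * a\<^sup>2)"
    by (simp add: algebra_simps)
  finally have "ln (c + d * b\<^sup>2) \<le> ln (K\<^sup>2 * (c + d * a\<^sup>2))"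
    using c assms by (subst ln_le_cancel_iff) (auto intro!: mult_pos_pos add_pos_nonneg)
  also have "\<dots> = 2 * ln K + ln (c + d * a\<^sup>2)"
    using c assms add_pos_nonneg[of c "d * a\<^sup>2"] by (simp add: ln_mult ln_realpow)
  finally show ?thesis by simp
qed

text \<open>Each of the two logarithms in \<open>reg_ln\<close> contributes at most
  \<open>2 * ln K\<close>, and their sum is halved. The bound is uniform in
  \<open>e\<close>.\<close>

lemma abs_reg_ln_diff_le:
  assumes "0 < e" "0 < a" "0 < b" "1 \<le> K" "b \<le> K * a" "a \<le> K * b"
  shows "\<bar>reg_ln e b - reg_ln e a\<bar> \<le> 2 * ln K"
  using ln_affine_square_diff_le[of "e\<^sup>2" 1 a b K] ln_affine_square_diff_le[of "e\<^sup>2" 1 b a K]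
    ln_affine_square_diff_le[of 1 "e\<^sup>2" a b K] ln_affine_square_diff_le[of 1 "e\<^sup>2" b a K] assms
  by (simp add: reg_ln_def abs_le_iff field_simps)

lemma exp_reg_ln_le:
  assumes "e > 0"
  shows "exp (reg_ln e a) \<le> sqrt (e\<^sup>2 + a\<^sup>2)"
proof -
  have "exp (reg_ln e a) \<le> exp (ln (e\<^sup>2 + a\<^sup>2) / 2)"
    using reg_ln_le[OF assms] by simp
  also have "\<dots> = sqrt (e\<^sup>2 + a\<^sup>2)"
    using sum_squares_pos[OF assms, of a] by (simp add: ln_sqrt[symmetric])
  finally show ?thesis .
qed

text \<open>With \<open>s = sqrt (e^2 + a^2)\<close>, the exponential is at most \<open>s\<close>,
  while \<open>cutoff e a = a^2 / s^2\<close> and \<open>cutoff' e a = 2 * a * e^2 / s^4\<close>.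
  The cutoff thus compensates for \<open>exp (reg_ln e a)\<close> being of order \<open>e\<close>
  instead of \<open>a\<close> near zero.\<close>

lemma cutoff_exp_reg_ln_le:
  assumes "e > 0" "a > 0"
  shows "cutoff e a * exp (reg_ln e a) \<le> a" "\<bar>cutoff' e a\<bar> * exp (reg_ln e a) \<le> 2"
proof -
  define s where "s = sqrt (e\<^sup>2 + a\<^sup>2)"
  have s: "s > 0" "s\<^sup>2 = e\<^sup>2 + a\<^sup>2" "a \<le> s" "e \<le> s" "exp (reg_ln e a) \<le> s"
    using assms sum_squares_pos[of e a] exp_reg_ln_le[of e a] real_sqrt_le_iff[of "a\<^sup>2" "e\<^sup>2 + a\<^sup>2"]
      real_sqrt_le_iff[of "e\<^sup>2" "e\<^sup>2 + a\<^sup>2"]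
    by (auto simp: s_def)
  have "cutoff e a * exp (reg_ln e a) \<le> cutoff e a * s"
    using s by (intro mult_left_mono) auto
  also have "\<dots> = a * a / s"
    unfolding cutoff_def s(2)[symmetric] using s(1) by (simp add: power2_eq_square)
  also have "\<dots> \<le> a"
    using s assms by (simp add: divide_simps)
  finally show "cutoff e a * exp (reg_ln e a) \<le> a" .
  have "\<bar>cutoff' e a\<bar> * exp (reg_ln e a) \<le> \<bar>cutoff' e a\<bar> * s"
    using s by (intro mult_left_mono) auto
  also have "\<dots> = 2 * (a * (e * e) / (s * (s * s)))"
    unfolding cutoff'_def s(2)[symmetric] using s(1) assms by (simp add: power2_eq_square abs_mult)
  also have "\<dots> \<le> 2"
  proof -
    have "a * (e * e) \<le> s * (s * s)"
      using s assms by (intro mult_mono) auto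
    then show ?thesis
      using s(1) by (simp add: divide_simps)
  qed
  finally show "\<bar>cutoff' e a\<bar> * exp (reg_ln e a) \<le> 2" .
qed

lemma reg_ln_param_tendsto:
  assumes "a > 0"
  shows "(\<lambda>n. reg_ln (1 / real (Suc n)) a) \<longlonglongrightarrow> ln a"
    "(\<lambda>n. reg_ln' (1 / real (Suc n)) a) \<longlonglongrightarrow> 1 / a"
proof -
  have e: "(\<lambda>n. 1 / real (Suc n)) \<longlonglongrightarrow> 0"
    using LIMSEQ_inverse_real_of_nat by (simp add: inverse_eq_divide)
  have "(\<lambda>n. reg_ln (1 / real (Suc n)) a) \<longlonglongrightarrow> (ln (0\<^sup>2 + a\<^sup>2) - ln (1 + 0\<^sup>2 * a\<^sup>2)) / 2"
    unfolding reg_ln_def using assms by (intro tendsto_intros e) auto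
  then show "(\<lambda>n. reg_ln (1 / real (Suc n)) a) \<longlonglongrightarrow> ln a"
    using assms by (simp add: ln_realpow)
  have "(\<lambda>n. reg_ln' (1 / real (Suc n)) a) \<longlonglongrightarrow> a / (0\<^sup>2 + a\<^sup>2) - 0\<^sup>2 * a / (1 + 0\<^sup>2 * a\<^sup>2)"
    unfolding reg_ln'_def using assms by (intro tendsto_intros e) auto
  then show "(\<lambda>n. reg_ln' (1 / real (Suc n)) a) \<longlonglongrightarrow> 1 / a"
    using assms by (simp add: power2_eq_square)
qed

section \<open>The Picone test functions\<close>

definition reg_weight :: "real \<Rightarrow> real \<Rightarrow> real \<Rightarrow> real \<Rightarrow> real \<Rightarrow> real" where
  "reg_weight e \<beta> m a b =
    exp (\<beta> * reg_ln e a + (1 - \<beta>) * reg_ln e b) * logistic (m * (reg_ln e b - reg_ln e a))"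

definition reg_test :: "real \<Rightarrow> real \<Rightarrow> real \<Rightarrow> real \<Rightarrow> real \<Rightarrow> real" where
  "reg_test e \<beta> m a b = cutoff e a * reg_weight e \<beta> m a b"

definition reg_test_a :: "real \<Rightarrow> real \<Rightarrow> real \<Rightarrow> real \<Rightarrow> real \<Rightarrow> real" where
  "reg_test_a e \<beta> m a b = cutoff' e a * reg_weight e \<beta> m a b + cutoff e a * reg_weight e \<beta> m a b *
    (reg_ln' e a * (\<beta> + m * (1 - logistic (m * (reg_ln e b - reg_ln e a)))))"

definition reg_test_b :: "real \<Rightarrow> real \<Rightarrow> real \<Rightarrow> real \<Rightarrow> real \<Rightarrow> real" where
  "reg_test_b e \<beta> m a b = cutoff e a * reg_weight e \<beta> m a b *
    (reg_ln' e b * (1 - \<beta> - m * (1 - logistic (m * (reg_ln e b - reg_ln e a)))))"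

text \<open>This is \<open>a powr \<beta> * b powr (1 - \<beta>) / (1 + (b / a) powr m)\<close>.\<close>
definition picone_test :: "real \<Rightarrow> real \<Rightarrow> real \<Rightarrow> real \<Rightarrow> real" where
  "picone_test \<beta> m a b = exp (\<beta> * ln a + (1 - \<beta>) * ln b) * logistic (m * (ln b - ln a))"

text \<open>The partial derivative of \<open>picone_test\<close> in \<open>a\<close>, written as the
  function times its logarithmic derivative. It arises as the limit of \<open>reg_test_a\<close>;
  likewise \<open>picone_test_b\<close> in the variable \<open>b\<close>.\<close>

definition picone_test_a :: "real \<Rightarrow> real \<Rightarrow> real \<Rightarrow> real \<Rightarrow> real" where
  "picone_test_a \<beta> m a b =
    picone_test \<beta> m a b * (1 / a * (\<beta> + m * (1 - logistic (m * (ln b - ln a)))))"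

definition picone_test_b :: "real \<Rightarrow> real \<Rightarrow> real \<Rightarrow> real \<Rightarrow> real" where
  "picone_test_b \<beta> m a b =
    picone_test \<beta> m a b * (1 / b * (1 - \<beta> - m * (1 - logistic (m * (ln b - ln a)))))"

lemma reg_weight_pos: "0 < reg_weight e \<beta> m a b"
  by (simp add: reg_weight_def logistic_bounds)

lemma reg_test_nonneg: "0 \<le> reg_test e \<beta> m a b"
  unfolding reg_test_def using reg_weight_pos by (intro mult_nonneg_nonneg) (auto intro: less_imp_le)

lemma smooth_reg_test:
  assumes "e > 0" "smooth f" "smooth g"
  shows "smooth (\<lambda>x. reg_test e \<beta> m (f x) (g x))"
  unfolding reg_test_def reg_weight_def
  by (intro smooth_mult smooth_cutoff smooth_exp smooth_add smooth_diff smooth_const smooth_logistic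
      smooth_reg_ln assms)

lemma DERIV_reg_test:
  assumes e: "e > 0" and f: "(f has_real_derivative f') (at t)" and g: "(g has_real_derivative g') (at t)"
  shows "((\<lambda>t. reg_test e \<beta> m (f t) (g t)) has_real_derivative
    (reg_test_a e \<beta> m (f t) (g t) * f' + reg_test_b e \<beta> m (f t) (g t) * g')) (at t)"
proof -
  let ?F = "reg_ln e (f t)" and ?G = "reg_ln e (g t)"
  let ?f = "reg_ln' e (f t) * f'" and ?g = "reg_ln' e (g t) * g'"
  note L = DERIV_reg_ln[OF e f] DERIV_reg_ln[OF e g]
  have 1: "((\<lambda>t. cutoff e (f t)) has_real_derivative cutoff' e (f t) * f') (at t)"
    by (rule DERIV_chain2[OF DERIV_cutoff[OF e] f])
  have 2: "((\<lambda>t. exp (\<beta> * reg_ln e (f t) + (1 - \<beta>) * reg_ln e (g t))) has_real_derivative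
      exp (\<beta> * ?F + (1 - \<beta>) * ?G) * (\<beta> * ?f + (1 - \<beta>) * ?g)) (at t)"
    by (intro DERIV_fun_exp DERIV_add DERIV_cmult L)
  have 3: "((\<lambda>t. logistic (m * (reg_ln e (g t) - reg_ln e (f t)))) has_real_derivative
      - logistic (m * (?G - ?F)) * (1 - logistic (m * (?G - ?F))) * (m * (?g - ?f))) (at t)"
    by (intro DERIV_logistic DERIV_cmult DERIV_diff L)
  \<comment> \<open>Collects the coefficients of \<open>f'\<close> and \<open>g'\<close> in the
    product rule. \<open>E\<close> stands for the exponential, \<open>S\<close> for the logistic
    factor, \<open>A\<close> and \<open>B\<close> for the values of \<open>reg_ln'\<close>.\<close>
  have *: "c' * f' * (E * S) + (E * (\<beta> * (A * f') + (1 - \<beta>) * (B * g')) * S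
        + - S * (1 - S) * (m * (B * g' - A * f')) * E) * c =
      (c' * (E * S) + c * (E * S) * (A * (\<beta> + m * (1 - S)))) * f'
      + c * (E * S) * (B * (1 - \<beta> - m * (1 - S))) * g'" for c c' E S A B :: real
    by algebra
  show ?thesis
    unfolding reg_test_def reg_test_a_def reg_test_b_def reg_weight_def
    using DERIV_mult[OF 1 DERIV_mult[OF 2 3]] unfolding * .
qed

lemma continuous_reg_test:
  assumes "e > 0"
  shows "continuous_on UNIV (\<lambda>z. reg_test e \<beta> m (fst z) (snd z))"
    "continuous_on UNIV (\<lambda>z. reg_test_a e \<beta> m (fst z) (snd z))"
    "continuous_on UNIV (\<lambda>z. reg_test_b e \<beta> m (fst z) (snd z))"
  unfolding reg_test_def reg_test_a_def reg_test_b_def reg_weight_def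
  by (intro continuous_intros assms)+

lemma exponent_bounds:
  fixes \<beta> m s :: real
  assumes "0 \<le> m" "0 < s" "s < 1"
  shows "\<bar>\<beta> + m * (1 - s)\<bar> \<le> \<bar>\<beta>\<bar> + \<bar>1 - \<beta>\<bar> + m" "\<bar>1 - \<beta> - m * (1 - s)\<bar> \<le> \<bar>\<beta>\<bar> + \<bar>1 - \<beta>\<bar> + m"
proof -
  have "0 \<le> m * (1 - s)" "m * (1 - s) \<le> m"
    using assms by (auto intro: mult_right_le_one_le)
  then show "\<bar>\<beta> + m * (1 - s)\<bar> \<le> \<bar>\<beta>\<bar> + \<bar>1 - \<beta>\<bar> + m" "\<bar>1 - \<beta> - m * (1 - s)\<bar> \<le> \<bar>\<beta>\<bar> + \<bar>1 - \<beta>\<bar> + m"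
    by linarith+
qed

text \<open>For fixed \<open>e\<close> the bound must hold for all real \<open>a\<close> and
  \<open>b\<close>, because the approximating test functions need be neither positive nor
  comparable. It may blow up as \<open>e \<rightarrow> 0\<close>.\<close>

lemma reg_test_bounded:
  assumes e: "0 < e" "e \<le> 1" and m: "0 \<le> m"
  obtains B where "0 \<le> B" "\<And>a b. \<bar>reg_test e \<beta> m a b\<bar> \<le> B" "\<And>a b. \<bar>reg_test_a e \<beta> m a b\<bar> \<le> B"
    "\<And>a b. \<bar>reg_test_b e \<beta> m a b\<bar> \<le> B"
proof -
  \<comment> \<open>\<open>X\<close> bounds the exponential through
    \<open>\<bar>reg_ln e a\<bar> \<le> - ln e\<close>, and \<open>C\<close> bounds the factors from
    \<open>exponent_bounds\<close>.\<close>
  define X where "X = exp ((\<bar>\<beta>\<bar> + \<bar>1 - \<beta>\<bar>) * (- ln e))"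
  define C where "C = \<bar>\<beta>\<bar> + \<bar>1 - \<beta>\<bar> + m"
  have X0: "0 \<le> X" and C0: "0 \<le> C" using m by (auto simp: X_def C_def)
  have wX: "reg_weight e \<beta> m a b \<le> X" for a b
  proof -
    have "\<beta> * reg_ln e a + (1 - \<beta>) * reg_ln e b \<le> \<bar>\<beta>\<bar> * \<bar>reg_ln e a\<bar> + \<bar>1 - \<beta>\<bar> * \<bar>reg_ln e b\<bar>"
      unfolding abs_mult[symmetric] by (intro add_mono abs_ge_self)
    also have "\<dots> \<le> \<bar>\<beta>\<bar> * (- ln e) + \<bar>1 - \<beta>\<bar> * (- ln e)"
      using e by (intro add_mono mult_left_mono abs_reg_ln_le) auto
    finally have "exp (\<beta> * reg_ln e a + (1 - \<beta>) * reg_ln e b) \<le> X"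
      by (simp add: X_def algebra_simps)
    then have "exp (\<beta> * reg_ln e a + (1 - \<beta>) * reg_ln e b) * logistic (m * (reg_ln e b - reg_ln e a)) \<le> X * 1"
      using X0 by (intro mult_mono less_imp_le[OF logistic_bounds(2)] less_imp_le[OF logistic_bounds(1)])
    then show ?thesis by (simp add: reg_weight_def)
  qed
  have hX: "cutoff e a * reg_weight e \<beta> m a b \<le> X" for a b
  proof -
    have "cutoff e a * reg_weight e \<beta> m a b \<le> 1 * X"
      by (intro mult_mono wX cutoff_le_1 less_imp_le[OF reg_weight_pos]) simp
    then show ?thesis by simp
  qed
  have hX0: "0 \<le> cutoff e a * reg_weight e \<beta> m a b" for a b
    using reg_test_nonneg by (simp add: reg_test_def)
  have L: "\<bar>reg_ln' e c * y\<bar> \<le> 2 / e * C" if "\<bar>y\<bar> \<le> C" for c y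
    unfolding abs_mult using that e by (intro mult_mono abs_reg_ln'_le) auto
  have main: "\<bar>cutoff e a * reg_weight e \<beta> m a b * y\<bar> \<le> X * (2 / e * C)" if "\<bar>y\<bar> \<le> 2 / e * C" for a b y
    unfolding abs_mult[of "cutoff e a * reg_weight e \<beta> m a b"] abs_of_nonneg[OF hX0]
    using that X0 by (intro mult_mono hX) auto
  have aux: "\<bar>cutoff' e a * reg_weight e \<beta> m a b\<bar> \<le> 1 / e * X" for a b
    unfolding abs_mult abs_of_pos[OF reg_weight_pos]
    using e by (intro mult_mono abs_cutoff'_le wX less_imp_le[OF reg_weight_pos]) auto
  let ?B = "X + 1 / e * X + X * (2 / e * C)"
  have pos: "0 \<le> 1 / e * X" "0 \<le> X * (2 / e * C)" using e X0 C0 by auto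
  show thesis
  proof (rule that[of ?B])
    show "0 \<le> ?B" using pos X0 by linarith
    fix a b
    show "\<bar>reg_test e \<beta> m a b\<bar> \<le> ?B"
      using hX[of a b] hX0[of a b] pos unfolding reg_test_def by linarith
    show "\<bar>reg_test_a e \<beta> m a b\<bar> \<le> ?B"
      unfolding reg_test_a_def
      using aux[of a b] main[OF L[OF exponent_bounds(1)[OF m logistic_bounds, of \<beta> "m * (reg_ln e b - reg_ln e a)", folded C_def]], of a b a]
        pos X0 by linarith
    show "\<bar>reg_test_b e \<beta> m a b\<bar> \<le> ?B"
      unfolding reg_test_b_def
      using main[OF L[OF exponent_bounds(2)[OF m logistic_bounds, of \<beta> "m * (reg_ln e b - reg_ln e a)", folded C_def]], of a b b]
        pos X0 by linarith
  qed
qed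

text \<open>Where \<open>a\<close> and \<open>b\<close> are comparable the bounds are free of
  \<open>e\<close>. The exponent is rewritten as
  \<open>reg_ln e a + (1 - \<beta>) * (reg_ln e b - reg_ln e a)\<close>, whose second part is
  bounded by the logarithm of \<open>\<kappa>\<close>.\<close>

lemma reg_test_cone_bounds:
  fixes e m a b K \<beta> :: real
  assumes e: "0 < e" and m: "0 \<le> m" and cone: "0 < a" "0 < b" "1 \<le> K" "b \<le> K * a" "a \<le> K * b"
  defines "C \<equiv> \<bar>\<beta>\<bar> + \<bar>1 - \<beta>\<bar> + m" and "\<kappa> \<equiv> exp (\<bar>1 - \<beta>\<bar> * (2 * ln K))"
  shows "reg_test e \<beta> m a b \<le> \<kappa> * a" "\<bar>reg_test_a e \<beta> m a b\<bar> \<le> \<kappa> * (2 + C)"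
    "\<bar>reg_test_b e \<beta> m a b\<bar> \<le> \<kappa> * (K * C)"
proof -
  have \<kappa>0: "0 \<le> \<kappa>" and C0: "0 \<le> C" using m by (auto simp: \<kappa>_def C_def)
  have w: "reg_weight e \<beta> m a b \<le> exp (reg_ln e a) * \<kappa>"
  proof -
    have "(1 - \<beta>) * (reg_ln e b - reg_ln e a) \<le> \<bar>1 - \<beta>\<bar> * \<bar>reg_ln e b - reg_ln e a\<bar>"
      unfolding abs_mult[symmetric] by simp
    also have "\<dots> \<le> \<bar>1 - \<beta>\<bar> * (2 * ln K)"
      using cone e by (intro mult_left_mono abs_reg_ln_diff_le) auto
    finally have "exp (\<beta> * reg_ln e a + (1 - \<beta>) * reg_ln e b) \<le> exp (reg_ln e a + \<bar>1 - \<beta>\<bar> * (2 * ln K))"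
      by (simp add: algebra_simps)
    then have "exp (\<beta> * reg_ln e a + (1 - \<beta>) * reg_ln e b) * logistic (m * (reg_ln e b - reg_ln e a))
        \<le> exp (reg_ln e a + \<bar>1 - \<beta>\<bar> * (2 * ln K)) * 1"
      by (intro mult_mono less_imp_le[OF logistic_bounds(2)] less_imp_le[OF logistic_bounds(1)]) auto
    then show ?thesis by (simp add: reg_weight_def \<kappa>_def exp_add)
  qed
  show H: "reg_test e \<beta> m a b \<le> \<kappa> * a"
  proof -
    have "cutoff e a * reg_weight e \<beta> m a b \<le> cutoff e a * (exp (reg_ln e a) * \<kappa>)"
      by (intro mult_left_mono w) simp
    also have "\<dots> = (cutoff e a * exp (reg_ln e a)) * \<kappa>" by simp
    also have "\<dots> \<le> a * \<kappa>"
      using cone e \<kappa>0 by (intro mult_right_mono cutoff_exp_reg_ln_le) auto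
    finally show ?thesis by (simp add: reg_test_def mult.commute)
  qed
  \<comment> \<open>Applied with \<open>c = a\<close>, \<open>M = 1\<close> for the derivative in
    \<open>a\<close>, and with \<open>c = b\<close>, \<open>M = K\<close> for the derivative in
    \<open>b\<close>.\<close>
  have main: "\<bar>cutoff e a * reg_weight e \<beta> m a b * (reg_ln' e c * y)\<bar> \<le> \<kappa> * (M * C)"
    if "\<bar>y\<bar> \<le> C" "0 < c" "a \<le> M * c" "0 \<le> M" for c y M
  proof -
    have "\<bar>cutoff e a * reg_weight e \<beta> m a b * (reg_ln' e c * y)\<bar>
        = reg_test e \<beta> m a b * (\<bar>reg_ln' e c\<bar> * \<bar>y\<bar>)"
      by (simp add: reg_test_def abs_mult abs_of_pos[OF reg_weight_pos])
    also have "\<dots> \<le> (\<kappa> * (M * c)) * (\<bar>reg_ln' e c\<bar> * \<bar>y\<bar>)"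
      using H that \<kappa>0 by (intro mult_right_mono) (auto intro: order_trans mult_left_mono)
    also have "\<dots> = \<kappa> * M * ((\<bar>reg_ln' e c\<bar> * c) * \<bar>y\<bar>)" by simp
    also have "\<dots> \<le> \<kappa> * M * (1 * C)"
      using that e \<kappa>0 by (intro mult_left_mono mult_mono abs_reg_ln'_mult_le) auto
    finally show ?thesis by simp
  qed
  have "\<bar>cutoff' e a * reg_weight e \<beta> m a b\<bar> \<le> \<kappa> * 2"
  proof -
    have "\<bar>cutoff' e a * reg_weight e \<beta> m a b\<bar> = \<bar>cutoff' e a\<bar> * reg_weight e \<beta> m a b"
      using reg_weight_pos[of e \<beta> m a b] by (simp add: abs_mult)
    also have "\<dots> \<le> \<bar>cutoff' e a\<bar> * (exp (reg_ln e a) * \<kappa>)"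
      by (intro mult_left_mono w) simp
    also have "\<dots> = (\<bar>cutoff' e a\<bar> * exp (reg_ln e a)) * \<kappa>" by simp
    also have "\<dots> \<le> 2 * \<kappa>"
      using cone e \<kappa>0 by (intro mult_right_mono cutoff_exp_reg_ln_le) auto
    finally show ?thesis by (simp add: mult.commute)
  qed
  moreover have "\<bar>cutoff e a * reg_weight e \<beta> m a b *
    (reg_ln' e a * (\<beta> + m * (1 - logistic (m * (reg_ln e b - reg_ln e a)))))\<bar> \<le> \<kappa> * (1 * C)"
    unfolding C_def using cone by (intro main[unfolded C_def] exponent_bounds m logistic_bounds) auto
  ultimately have "\<bar>reg_test_a e \<beta> m a b\<bar> \<le> \<kappa> * 2 + \<kappa> * (1 * C)"
    unfolding reg_test_a_def by linarith
  then show "\<bar>reg_test_a e \<beta> m a b\<bar> \<le> \<kappa> * (2 + C)"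
    by (simp add: distrib_left)
  show "\<bar>reg_test_b e \<beta> m a b\<bar> \<le> \<kappa> * (K * C)"
    unfolding C_def reg_test_b_def
    using cone by (intro main[unfolded C_def] exponent_bounds m logistic_bounds) auto
qed

lemma reg_test_param_tendsto:
  assumes "0 < a" "0 < b"
  shows "(\<lambda>n. reg_test (1 / real (Suc n)) \<beta> m a b) \<longlonglongrightarrow> picone_test \<beta> m a b"
    "(\<lambda>n. reg_test_a (1 / real (Suc n)) \<beta> m a b) \<longlonglongrightarrow> picone_test_a \<beta> m a b"
    "(\<lambda>n. reg_test_b (1 / real (Suc n)) \<beta> m a b) \<longlonglongrightarrow> picone_test_b \<beta> m a b"
proof -
  have logistic: "(\<lambda>n. logistic (f n)) \<longlonglongrightarrow> logistic y" if "f \<longlonglongrightarrow> y" for f and y :: real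
    unfolding logistic_def by (intro tendsto_intros that one_plus_exp_neq_0)
  have a0: "a \<noteq> 0" using assms by simp
  note t = reg_ln_param_tendsto[OF assms(1)] reg_ln_param_tendsto[OF assms(2)] cutoff_param_tendsto[OF a0]
  have w: "(\<lambda>n. reg_weight (1 / real (Suc n)) \<beta> m a b) \<longlonglongrightarrow> picone_test \<beta> m a b"
    unfolding reg_weight_def picone_test_def by (intro tendsto_intros logistic t)
  have "(\<lambda>n. reg_test (1 / real (Suc n)) \<beta> m a b) \<longlonglongrightarrow> 1 * picone_test \<beta> m a b"
    unfolding reg_test_def by (intro tendsto_intros w t)
  then show "(\<lambda>n. reg_test (1 / real (Suc n)) \<beta> m a b) \<longlonglongrightarrow> picone_test \<beta> m a b" by simp
  have "(\<lambda>n. reg_test_a (1 / real (Suc n)) \<beta> m a b) \<longlonglongrightarrow> 0 * picone_test \<beta> m a b + 1 * picone_test \<beta> m a b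
    * (1 / a * (\<beta> + m * (1 - logistic (m * (ln b - ln a)))))"
    unfolding reg_test_a_def by (intro tendsto_intros w t logistic)
  then show "(\<lambda>n. reg_test_a (1 / real (Suc n)) \<beta> m a b) \<longlonglongrightarrow> picone_test_a \<beta> m a b"
    by (simp add: picone_test_a_def)
  have "(\<lambda>n. reg_test_b (1 / real (Suc n)) \<beta> m a b) \<longlonglongrightarrow> 1 * picone_test \<beta> m a b
    * (1 / b * (1 - \<beta> - m * (1 - logistic (m * (ln b - ln a)))))"
    unfolding reg_test_b_def by (intro tendsto_intros w t logistic)
  then show "(\<lambda>n. reg_test_b (1 / real (Suc n)) \<beta> m a b) \<longlonglongrightarrow> picone_test_b \<beta> m a b"
    by (simp add: picone_test_b_def)
qed

lemma measurable_picone_test [measurable]: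
  assumes [measurable]: "f \<in> borel_measurable M" "g \<in> borel_measurable M"
  shows "(\<lambda>x. picone_test \<beta> m (f x) (g x)) \<in> borel_measurable M"
    "(\<lambda>x. picone_test_a \<beta> m (f x) (g x)) \<in> borel_measurable M"
    "(\<lambda>x. picone_test_b \<beta> m (f x) (g x)) \<in> borel_measurable M"
  unfolding picone_test_def picone_test_a_def picone_test_b_def logistic_def by measurable

section \<open>Testing the weak inequality with the Picone functions\<close>

context weak_inequality
begin

text \<open>For each \<open>n\<close> the regularised function \<open>reg_test\<close> with
  parameter \<open>1 / Suc n\<close> is admissible by \<open>weak_inequality_composition\<close>.
  The cone bounds then give majorants independent of \<open>n\<close>, namely multiples of
  \<open>D\<close> and of \<open>\<bar>h x * u x\<bar>\<close>.\<close>

lemma picone_weak_inequality: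
  assumes m: "0 \<le> m" and K: "1 \<le> K"
    and cone: "AE x in lebesgue_on \<Omega>. 0 < v x \<and> v x \<le> K * u x \<and> u x \<le> K * v x"
    and hu: "integrable (lebesgue_on \<Omega>) (\<lambda>x. h x * u x)"
  shows "(\<integral>x. T x \<bullet> (picone_test_a \<beta> m (u x) (v x) *\<^sub>R U x
      + picone_test_b \<beta> m (u x) (v x) *\<^sub>R V x) \<partial>lebesgue_on \<Omega>)
    \<le> (\<integral>x. h x * picone_test \<beta> m (u x) (v x) \<partial>lebesgue_on \<Omega>)" (is ?le)
    and "integrable (lebesgue_on \<Omega>) (\<lambda>x. T x \<bullet> (picone_test_a \<beta> m (u x) (v x) *\<^sub>R U x
      + picone_test_b \<beta> m (u x) (v x) *\<^sub>R V x))" (is ?i1)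
    and "integrable (lebesgue_on \<Omega>) (\<lambda>x. h x * picone_test \<beta> m (u x) (v x))" (is ?i2)
proof -
  let ?M = "lebesgue_on \<Omega>" and ?e = "\<lambda>n. 1 / real (Suc n)"
  define C where "C = \<bar>\<beta>\<bar> + \<bar>1 - \<beta>\<bar> + m"
  define \<kappa> where "\<kappa> = exp (\<bar>1 - \<beta>\<bar> * (2 * ln K))"
  have e: "0 < ?e n" "?e n \<le> 1" for n by auto
  note bd = reg_test_cone_bounds[OF e(1) m, where K = K and \<beta> = \<beta>, folded C_def \<kappa>_def]
  have hE: "AE x in ?M. \<bar>h x\<bar> * reg_test (?e n) \<beta> m (u x) (v x) \<le> \<kappa> * \<bar>h x * u x\<bar>" for n
    using cone upos
  proof eventually_elim
    case (elim x)
    have "\<bar>h x\<bar> * reg_test (?e n) \<beta> m (u x) (v x) \<le> \<bar>h x\<bar> * (\<kappa> * u x)"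
      using elim K by (intro mult_left_mono bd) auto
    then show ?case using elim by (simp add: abs_mult mult_ac)
  qed
  have iE: "integrable ?M (\<lambda>x. \<kappa> * \<bar>h x * u x\<bar>)"
    using hu by simp
  have step: "(\<integral>x. T x \<bullet> (reg_test_a (?e n) \<beta> m (u x) (v x) *\<^sub>R U x
        + reg_test_b (?e n) \<beta> m (u x) (v x) *\<^sub>R V x) \<partial>?M)
      \<le> (\<integral>x. h x * reg_test (?e n) \<beta> m (u x) (v x) \<partial>?M)" for n
  proof -
    obtain B where B: "0 \<le> B" "\<And>a b. \<bar>reg_test (?e n) \<beta> m a b\<bar> \<le> B"
        "\<And>a b. \<bar>reg_test_a (?e n) \<beta> m a b\<bar> \<le> B" "\<And>a b. \<bar>reg_test_b (?e n) \<beta> m a b\<bar> \<le> B"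
      using reg_test_bounded[OF e m, where \<beta> = \<beta>] by metis
    have \<kappa>0: "0 \<le> \<kappa>" by (simp add: \<kappa>_def)
    show ?thesis
    \<comment> \<open>\<open>B\<close> gives the global bounds at this \<open>n\<close> and
      \<open>\<kappa>\<close> the linear bound by \<open>u\<close>; their sum serves both
      purposes.\<close>
    proof (rule weak_inequality_composition[where B = "B + \<kappa>" and E = "\<lambda>x. \<kappa> * \<bar>h x * u x\<bar>"])
      show "AE x in ?M. reg_test (?e n) \<beta> m (u x) (v x) \<le> (B + \<kappa>) * u x"
        using cone upos
      proof eventually_elim
        case (elim x)
        have "reg_test (?e n) \<beta> m (u x) (v x) \<le> \<kappa> * u x"
          using elim K by (intro bd) auto
        also have "\<dots> \<le> (B + \<kappa>) * u x"
          using elim B(1) by (intro mult_right_mono) auto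
        finally show ?case .
      qed
      show "AE x in ?M. \<bar>h x\<bar> * reg_test (?e n) \<beta> m (u x) (v x) \<le> \<kappa> * \<bar>h x * u x\<bar>"
        by (rule hE)
    qed (use e B \<kappa>0 in \<open>auto intro!: smooth_reg_test DERIV_reg_test continuous_reg_test reg_test_nonneg hu
          intro: add_increasing2\<close>)
  qed
  \<comment> \<open>The term \<open>0 *\<^sub>R U x\<close> pads the vector to the three-term form
    of \<open>abs_inner_lincomb_le\<close>.\<close>
  have "(\<integral>x. T x \<bullet> (0 *\<^sub>R U x + picone_test_a \<beta> m (u x) (v x) *\<^sub>R U x
        + picone_test_b \<beta> m (u x) (v x) *\<^sub>R V x) \<partial>?M)
      \<le> (\<integral>x. h x * picone_test \<beta> m (u x) (v x) \<partial>?M) \<and>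
    integrable ?M (\<lambda>x. T x \<bullet> (0 *\<^sub>R U x + picone_test_a \<beta> m (u x) (v x) *\<^sub>R U x
        + picone_test_b \<beta> m (u x) (v x) *\<^sub>R V x)) \<and>
    integrable ?M (\<lambda>x. h x * picone_test \<beta> m (u x) (v x))"
  proof (rule integral_le_dominated_limit_integrable)
    fix n
    show "(\<integral>x. T x \<bullet> (0 *\<^sub>R U x + reg_test_a (?e n) \<beta> m (u x) (v x) *\<^sub>R U x
        + reg_test_b (?e n) \<beta> m (u x) (v x) *\<^sub>R V x) \<partial>?M)
      \<le> (\<integral>x. h x * reg_test (?e n) \<beta> m (u x) (v x) \<partial>?M)"
      using step[of n] by simp
    note [measurable] = borel_measurable_continuous_Pair[OF _ _ continuous_reg_test(1)[OF e(1)]]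
      borel_measurable_continuous_Pair[OF _ _ continuous_reg_test(2)[OF e(1)]]
      borel_measurable_continuous_Pair[OF _ _ continuous_reg_test(3)[OF e(1)]]
    show "(\<lambda>x. T x \<bullet> (0 *\<^sub>R U x + reg_test_a (?e n) \<beta> m (u x) (v x) *\<^sub>R U x
        + reg_test_b (?e n) \<beta> m (u x) (v x) *\<^sub>R V x)) \<in> borel_measurable ?M"
      "(\<lambda>x. h x * reg_test (?e n) \<beta> m (u x) (v x)) \<in> borel_measurable ?M"
      by measurable
  next
    show "integrable ?M (\<lambda>x. (0 + \<kappa> * (2 + C) + \<kappa> * (K * C)) * D x)"
      using D(1) by simp
    show "AE x in ?M. \<forall>n. \<bar>T x \<bullet> (0 *\<^sub>R U x + reg_test_a (?e n) \<beta> m (u x) (v x) *\<^sub>R U x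
        + reg_test_b (?e n) \<beta> m (u x) (v x) *\<^sub>R V x)\<bar> \<le> (0 + \<kappa> * (2 + C) + \<kappa> * (K * C)) * D x"
      using D(4,5) cone upos
      by eventually_elim (intro allI abs_inner_lincomb_le bd K; simp)
    show "AE x in ?M. (\<lambda>n. T x \<bullet> (0 *\<^sub>R U x + reg_test_a (?e n) \<beta> m (u x) (v x) *\<^sub>R U x
        + reg_test_b (?e n) \<beta> m (u x) (v x) *\<^sub>R V x)) \<longlonglongrightarrow>
      T x \<bullet> (0 *\<^sub>R U x + picone_test_a \<beta> m (u x) (v x) *\<^sub>R U x + picone_test_b \<beta> m (u x) (v x) *\<^sub>R V x)"
      using cone upos by eventually_elim (intro tendsto_intros reg_test_param_tendsto; simp)
    show "integrable ?M (\<lambda>x. \<kappa> * \<bar>h x * u x\<bar>)" by (rule iE)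
    have "AE x in ?M. \<forall>n. \<bar>h x\<bar> * reg_test (?e n) \<beta> m (u x) (v x) \<le> \<kappa> * \<bar>h x * u x\<bar>"
      using hE by (simp add: AE_all_countable)
    then show "AE x in ?M. \<forall>n. \<bar>h x * reg_test (?e n) \<beta> m (u x) (v x)\<bar> \<le> \<kappa> * \<bar>h x * u x\<bar>"
      by (simp add: abs_mult reg_test_nonneg)
    show "AE x in ?M. (\<lambda>n. h x * reg_test (?e n) \<beta> m (u x) (v x)) \<longlonglongrightarrow> h x * picone_test \<beta> m (u x) (v x)"
      using cone upos by eventually_elim (intro tendsto_intros reg_test_param_tendsto; simp)
  qed measurable
  then show ?le ?i1 ?i2 by simp_all
qed

end

section \<open>Pointwise inequalities for the flux of the \<open>r\<close>-Laplacian\<close>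

lemma young_powr:
  fixes a b r :: real
  assumes "1 < r" "0 \<le> a" "0 \<le> b"
  shows "r * (a powr (r - 1) * b) \<le> (r - 1) * a powr r + b powr r"
proof -
  have "(r - 1) * (r / (r - 1)) = r"
    using assms by simp
  then have "(a powr (r - 1)) powr (r / (r - 1)) = a powr r"
    by (simp only: powr_powr)
  moreover have "a powr (r - 1) * b \<le> (a powr (r - 1)) powr (r / (r - 1)) / (r / (r - 1)) + b powr r / r"
    using assms by (intro Youngs_inequality) (auto simp: field_simps)
  ultimately have "r * (a powr (r - 1) * b) \<le> r * (a powr r / (r / (r - 1)) + b powr r / r)"
    using assms by (intro mult_left_mono) auto
  also have "\<dots> = (r - 1) * a powr r + b powr r"
    using assms by (simp add: distrib_left)
  finally show ?thesis .
qed

text \<open>At \<open>X = 0\<close> both sides vanish because \<open>0 powr y = 0\<close>, so the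
  singular range \<open>r < 2\<close> is included.\<close>

lemma powr_minus_2_mult_norm:
  fixes X :: "'a::real_normed_vector"
  shows "norm X powr (r - 2) * norm X = norm X powr (r - 1)"
  using powr_mult_base[of "norm X" "r - 2"] by (simp add: mult.commute)

lemma norm_p_flux:
  fixes X :: "'a::real_normed_vector"
  shows "norm (norm X powr (r - 2) *\<^sub>R X) = norm X powr (r - 1)"
  by (simp add: powr_minus_2_mult_norm)

lemma p_flux_inner_self:
  fixes X :: "'a::real_inner"
  shows "(norm X powr (r - 2) *\<^sub>R X) \<bullet> X = norm X powr r"
proof -
  have "(norm X powr (r - 2) *\<^sub>R X) \<bullet> X = (norm X powr (r - 2) * norm X) * norm X"
    by (simp add: dot_square_norm power2_eq_square)
  also have "\<dots> = norm X powr r"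
    unfolding powr_minus_2_mult_norm using powr_mult_base[of "norm X" "r - 1"] by (simp add: mult.commute)
  finally show ?thesis .
qed

lemma p_flux_inner_le:
  fixes X Y :: "'a::real_inner"
  shows "(norm X powr (r - 2) *\<^sub>R X) \<bullet> Y \<le> norm X powr (r - 1) * norm Y"
  using norm_cauchy_schwarz[of "norm X powr (r - 2) *\<^sub>R X" Y] unfolding norm_p_flux .

text \<open>The tangent inequality at \<open>Y\<close> for the convex function
  \<open>X \<mapsto> norm X powr r\<close>, with the terms in \<open>norm Y powr r\<close>
  collected. Cauchy-Schwarz reduces it to Young's inequality for the norms.\<close>

lemma p_flux_convexity:
  fixes X Y :: "'a::real_inner"
  assumes "1 < r"
  shows "0 \<le> norm X powr r - r * ((norm Y powr (r - 2) *\<^sub>R Y) \<bullet> X) + (r - 1) * norm Y powr r"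
proof -
  have "r * ((norm Y powr (r - 2) *\<^sub>R Y) \<bullet> X) \<le> r * (norm Y powr (r - 1) * norm X)"
    using assms by (intro mult_left_mono p_flux_inner_le) simp
  with young_powr[OF assms, of "norm Y" "norm X"] show ?thesis by simp
qed

text \<open>The expanded inner product of the difference of the fluxes with \<open>X - Y\<close>.
  Cauchy-Schwarz reduces it to the monotonicity of
  \<open>t \<mapsto> t powr (r - 1)\<close>.\<close>

lemma p_flux_monotone:
  fixes X Y :: "'a::real_inner"
  assumes "1 < r"
  shows "0 \<le> norm X powr r - (norm X powr (r - 2) *\<^sub>R X) \<bullet> Y - (norm Y powr (r - 2) *\<^sub>R Y) \<bullet> X
    + norm Y powr r"
proof -
  have "0 \<le> (norm X powr (r - 1) - norm Y powr (r - 1)) * (norm X - norm Y)"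
    using assms powr_mono2[of "r - 1" "norm X" "norm Y"] powr_mono2[of "r - 1" "norm Y" "norm X"]
    by (cases "norm X \<le> norm Y") (auto intro!: mult_nonpos_nonpos)
  also have "\<dots> = norm X powr r - norm X powr (r - 1) * norm Y - norm Y powr (r - 1) * norm X + norm Y powr r"
    using powr_mult_base[of "norm X" "r - 1"] powr_mult_base[of "norm Y" "r - 1"]
    by (simp add: algebra_simps)
  finally show ?thesis
    using p_flux_inner_le[of X r Y] p_flux_inner_le[of Y r X] by linarith
qed

text \<open>With \<open>s = b / a\<close> and \<open>W = V / s\<close>, the difference is \<open>logistic (m * ln s)\<close> times a nonnegative
  combination of the convexity and monotonicity defects of \<open>X \<mapsto> |X| powr r\<close> at \<open>U\<close> and \<open>W\<close>.\<close>
lemma picone_pointwise: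
  fixes U V :: "'a::real_inner"
  assumes r: "1 < r" and m: "0 \<le> m" and ab: "0 < a" "0 < b"
  shows "0 \<le> (norm U powr (r - 2) *\<^sub>R U) \<bullet> (picone_test_a 1 m a b *\<^sub>R U + picone_test_b 1 m a b *\<^sub>R V)
    - (norm V powr (r - 2) *\<^sub>R V) \<bullet> (picone_test_a r m a b *\<^sub>R U + picone_test_b r m a b *\<^sub>R V)"
proof -
  define s where "s = b / a"
  define q where "q = logistic (m * (ln b - ln a))"
  define \<sigma> where "\<sigma> = m * (1 - q)"
  define W where "W = (1 / s) *\<^sub>R V"
  define A where "A X = norm X powr (r - 2) *\<^sub>R X" for X :: 'a
  have s: "s > 0" and b: "b = s * a" using ab by (auto simp: s_def)
  have V: "V = s *\<^sub>R W" using s by (simp add: W_def)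
  have q: "0 < q" "q < 1" by (auto simp: q_def logistic_bounds)
  have \<sigma>: "0 \<le> \<sigma>" using m q by (simp add: \<sigma>_def)
  \<comment> \<open>The flux is homogeneous of degree \<open>r - 1\<close>.\<close>
  have AV: "A V = s powr (r - 1) *\<^sub>R A W"
    using s powr_mult_base[of s "r - 2"] by (simp add: A_def V powr_mult mult_ac)
  have p: "picone_test \<beta> m a b = a * s powr (1 - \<beta>) * q" for \<beta>
  proof -
    have "exp (\<beta> * ln a + (1 - \<beta>) * ln b) = exp (ln a + (1 - \<beta>) * ln s)"
      using ab s by (simp add: b ln_mult algebra_simps)
    then show ?thesis
      using ab s by (simp add: picone_test_def q_def exp_add powr_def)
  qed
  have pa: "picone_test_a \<beta> m a b = s powr (1 - \<beta>) * q * (\<beta> + \<sigma>)" for \<beta>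
    using ab by (simp add: picone_test_a_def p \<sigma>_def q_def)
  have pb: "picone_test_b \<beta> m a b * s = s powr (1 - \<beta>) * q * (1 - \<beta> - \<sigma>)" for \<beta>
    using ab by (simp add: picone_test_b_def p \<sigma>_def q_def s_def)
  \<comment> \<open>The power from homogeneity cancels the one in the test function with
    \<open>\<beta> = r\<close>. This is why the exponents 1 and \<open>r\<close> belong together:
    both sides end up with the same weight \<open>q\<close>.\<close>
  have ss: "s powr (r - 1) * s powr (1 - r) = 1"
    using s by (simp add: powr_add[symmetric])
  have "(A U) \<bullet> (picone_test_a 1 m a b *\<^sub>R U + picone_test_b 1 m a b *\<^sub>R V)
      = q * ((1 + \<sigma>) * (A U \<bullet> U) - \<sigma> * (A U \<bullet> W))"
    unfolding V scaleR_scaleR pa pb using s by (simp add: inner_add_right algebra_simps)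
  moreover have "(A V) \<bullet> (picone_test_a r m a b *\<^sub>R U + picone_test_b r m a b *\<^sub>R V)
      = (s powr (r - 1) * s powr (1 - r)) * (q * ((r + \<sigma>) * (A W \<bullet> U) + (1 - r - \<sigma>) * (A W \<bullet> W)))"
    unfolding AV unfolding V scaleR_scaleR pa pb by (simp add: inner_add_right algebra_simps)
  ultimately have "(A U) \<bullet> (picone_test_a 1 m a b *\<^sub>R U + picone_test_b 1 m a b *\<^sub>R V)
      - (A V) \<bullet> (picone_test_a r m a b *\<^sub>R U + picone_test_b r m a b *\<^sub>R V)
    = q * ((A U \<bullet> U - r * (A W \<bullet> U) + (r - 1) * (A W \<bullet> W))
      + \<sigma> * (A U \<bullet> U - A U \<bullet> W - A W \<bullet> U + A W \<bullet> W))"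
    unfolding ss by (simp add: algebra_simps)
  also have "0 \<le> \<dots>"
    unfolding A_def p_flux_inner_self
    by (rule mult_nonneg_nonneg[OF less_imp_le[OF q(1)] add_nonneg_nonneg[OF
          p_flux_convexity[OF r] mult_nonneg_nonneg[OF \<sigma> p_flux_monotone[OF r]]]])
  finally show ?thesis unfolding A_def .
qed

section \<open>The comparison principle\<close>

lemma logistic_tendsto:
  "y < 0 \<Longrightarrow> (\<lambda>n. logistic (real n * y)) \<longlonglongrightarrow> 1"
  "y > 0 \<Longrightarrow> (\<lambda>n. logistic (real n * y)) \<longlonglongrightarrow> 0"
proof -
  assume y: "y < 0"
  then have "(\<lambda>n. exp y ^ n) \<longlonglongrightarrow> 0"
    by (intro LIMSEQ_realpow_zero) auto
  then have "(\<lambda>n. 1 / (1 + exp y ^ n)) \<longlonglongrightarrow> 1 / (1 + 0)"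
    using y by (intro tendsto_intros) auto
  then show "(\<lambda>n. logistic (real n * y)) \<longlonglongrightarrow> 1"
    by (simp add: logistic_def exp_of_nat_mult)
next
  assume "y > 0"
  then have "(\<lambda>n. exp (- y) ^ n) \<longlonglongrightarrow> 0"
    by (intro LIMSEQ_realpow_zero) auto
  moreover have "logistic (real n * y) \<le> exp (- y) ^ n" for n
  proof -
    have "logistic (real n * y) \<le> 1 / exp (real n * y)"
      unfolding logistic_def by (intro divide_left_mono) (auto intro!: mult_pos_pos add_pos_pos)
    also have "\<dots> = exp (real n * (- y))"
      by (simp add: exp_minus inverse_eq_divide)
    also have "\<dots> = exp (- y) ^ n"
      by (rule exp_of_nat_mult)
    finally show ?thesis .
  qed
  ultimately have "eventually (\<lambda>n. logistic (real n * y) \<le> exp (- y) ^ n) sequentially"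
    "(\<lambda>n. exp (- y) ^ n) \<longlonglongrightarrow> 0"
    by (simp_all only: eventually_True)
  moreover have "eventually (\<lambda>n. 0 \<le> logistic (real n * y)) sequentially"
    by (rule always_eventually) (rule allI, rule less_imp_le[OF logistic_bounds(1)])
  ultimately show "(\<lambda>n. logistic (real n * y)) \<longlonglongrightarrow> 0"
    by (rule tendsto_sandwich[OF _ _ tendsto_const, rotated 1])
qed

text \<open>Monotonicity of the quotient bounds \<open>G w\<close> from above by its value at the
  left end \<open>a\<close> and from below by its value at the right end \<open>b\<close>. In this
  way \<open>g\<close> is controlled between \<open>c * u0\<close> and \<open>C * u0\<close> by its
  values at these two functions.\<close>

lemma abs_between_quotient_decreasing:
  fixes G :: "real \<Rightarrow> real"
  assumes decr: "\<forall>s t. 0 < s \<and> s < t \<longrightarrow> G t / t powr p \<le> G s / s powr p"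
    and p: "0 \<le> p" and abw: "0 < a" "a \<le> w" "w \<le> b"
  shows "\<bar>G w\<bar> \<le> \<bar>G b\<bar> + (b / a) powr p * \<bar>G a\<bar>"
proof -
  have decr': "G t / t powr p \<le> G s / s powr p" if "0 < s" "s \<le> t" for s t
    using decr that by (cases "s = t") auto
  have pos: "0 < a powr p" "0 < w powr p" "0 < b powr p" using abw by auto
  have "G w / w powr p \<le> \<bar>G a\<bar> / a powr p"
    using decr'[OF abw(1,2)] divide_right_mono[OF abs_ge_self[of "G a"] less_imp_le[OF pos(1)]] by linarith
  then have "G w \<le> w powr p * (\<bar>G a\<bar> / a powr p)"
    using pos by (simp add: pos_divide_le_eq mult.commute)
  also have "\<dots> \<le> b powr p * (\<bar>G a\<bar> / a powr p)"
    using abw p pos by (intro mult_right_mono powr_mono2) auto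
  also have "\<dots> = (b / a) powr p * \<bar>G a\<bar>"
    using abw by (simp add: powr_divide)
  finally have 1: "G w \<le> (b / a) powr p * \<bar>G a\<bar>" .
  have "- \<bar>G b\<bar> / b powr p \<le> G w / w powr p"
    using decr'[of w b] abw divide_right_mono[of "- \<bar>G b\<bar>" "G b" "b powr p"] pos by force
  then have "- G w / w powr p \<le> \<bar>G b\<bar> / b powr p"
    unfolding minus_divide_left[symmetric] by linarith
  then have "- G w \<le> w powr p * (\<bar>G b\<bar> / b powr p)"
    unfolding pos_divide_le_eq[OF pos(2)] by (simp only: mult.commute)
  also have "\<dots> \<le> b powr p * (\<bar>G b\<bar> / b powr p)"
    using abw p pos by (intro mult_right_mono powr_mono2) auto
  also have "\<dots> = \<bar>G b\<bar>"
    using pos by simp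
  finally have 2: "- G w \<le> \<bar>G b\<bar>" .
  have "0 \<le> (b / a) powr p * \<bar>G a\<bar>" by simp
  with 1 2 show ?thesis by linarith
qed

lemma test_fun_power2:
  assumes "test_fun \<Omega> p"
  shows "test_fun \<Omega> (\<lambda>x. (p x)\<^sup>2)"
proof -
  obtain K where "compact K" "K \<subseteq> \<Omega>" "\<forall>x. x \<notin> K \<longrightarrow> p x = 0"
    using assms unfolding test_fun_def by blast
  then show ?thesis
    using assms unfolding test_fun_def by (intro conjI smooth_power2 exI[of _ K]) auto
qed

text \<open>Only integrability of \<open>h * p\<close> for test functions \<open>p\<close> is given, so \<open>h\<close> is recovered a.e. as a limit.\<close>
lemma borel_measurable_of_test_functions:
  fixes h u :: "real^'n \<Rightarrow> real"
  assumes \<Omega>: "open \<Omega>" and \<phi>: "\<And>k. test_fun \<Omega> (\<phi> k)"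
    and u [measurable]: "u \<in> borel_measurable (lebesgue_on \<Omega>)"
    and lim: "AE x in lebesgue_on \<Omega>. (\<lambda>k. \<phi> k x) \<longlonglongrightarrow> u x"
    and pos: "AE x in lebesgue_on \<Omega>. 0 < u x"
    and test: "\<And>p. test_fun \<Omega> p \<Longrightarrow> (\<And>x. 0 \<le> p x) \<Longrightarrow> integrable (lebesgue_on \<Omega>) (\<lambda>x. h x * p x)"
  shows "h \<in> borel_measurable (lebesgue_on \<Omega>)"
proof (rule borel_measurable_lebesgue_on_AE)
  \<comment> \<open>The square makes the test function nonnegative, as the integrability hypothesis
    requires.\<close>
  let ?f = "\<lambda>k x. h x * (\<phi> k x)\<^sup>2"
  show "\<Omega> \<in> sets lebesgue" using \<Omega> by auto
  have [measurable]: "?f k \<in> borel_measurable (lebesgue_on \<Omega>)" for k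
    using test[OF test_fun_power2[OF \<phi>]] by auto
  have [measurable]: "(\<lambda>x. lim (\<lambda>k. ?f k x)) \<in> borel_measurable (lebesgue_on \<Omega>)"
    by (rule borel_measurable_lim_metric) measurable
  show "(\<lambda>x. lim (\<lambda>k. ?f k x) / (u x)\<^sup>2) \<in> borel_measurable (lebesgue_on \<Omega>)"
    by measurable
  show "AE x in lebesgue_on \<Omega>. lim (\<lambda>k. ?f k x) / (u x)\<^sup>2 = h x"
    using lim pos
  proof eventually_elim
    case (elim x)
    have "(\<lambda>k. ?f k x) \<longlonglongrightarrow> h x * (u x)\<^sup>2"
      by (intro tendsto_intros elim)
    then show ?case
      using elim(2) by (simp add: limI)
  qed
qed

text \<open>Replace the smaller norm by the larger one. This yields an integrable majorant for the
  flux of one function paired with the gradient of another.\<close>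

lemma norm_p_flux_mult_le:
  fixes X Y :: "'a::real_normed_vector"
  assumes "1 < r"
  shows "norm (norm X powr (r - 2) *\<^sub>R X) * norm Y \<le> norm X powr r + norm Y powr r"
proof -
  have sq: "z powr (r - 1) * z = z powr r" if "0 \<le> z" for z
    using powr_mult_base[OF that, of "r - 1"] by (simp add: mult.commute)
  have "norm X powr (r - 1) * norm Y \<le> norm X powr r + norm Y powr r"
  proof (cases "norm Y \<le> norm X")
    case True
    then have "norm X powr (r - 1) * norm Y \<le> norm X powr (r - 1) * norm X"
      by (intro mult_left_mono) auto
    then show ?thesis
      by (simp add: sq add_increasing2)
  next
    case False
    then have "norm X powr (r - 1) * norm Y \<le> norm Y powr (r - 1) * norm Y"
      using assms by (intro mult_right_mono powr_mono2) auto
    then show ?thesis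
      by (simp add: sq add_increasing)
  qed
  then show ?thesis
    unfolding norm_p_flux .
qed

text \<open>The singular part contributes \<open>w powr (1 - \<delta>)\<close>. For \<open>g\<close>
  the endpoint bound applies with the constant ratio \<open>C / c\<close> of the endpoints, and the
  factor \<open>w x\<close> is replaced by \<open>C * u0 x\<close>.\<close>

lemma reaction_integrable:
  fixes \<Omega> :: "(real^'n) set" and w u0 :: "real^'n \<Rightarrow> real"
  assumes r: "1 < r"
    and gdecr: "AE x in lebesgue_on \<Omega>. \<forall>s t. 0 < s \<and> s < t \<longrightarrow> g x t / t powr (r - 1) \<le> g x s / s powr (r - 1)"
    and pos: "AE x in lebesgue_on \<Omega>. 0 < u0 x" and c: "0 < c" "0 < C"
    and bounds: "AE x in lebesgue_on \<Omega>. c * u0 x \<le> w x \<and> w x \<le> C * u0 x"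
    and int: "integrable (lebesgue_on \<Omega>) (\<lambda>x. w x powr (1 - \<delta>))"
      "integrable (lebesgue_on \<Omega>) (\<lambda>x. \<bar>g x (c * u0 x)\<bar> * u0 x)"
      "integrable (lebesgue_on \<Omega>) (\<lambda>x. \<bar>g x (C * u0 x)\<bar> * u0 x)"
    and meas: "w \<in> borel_measurable (lebesgue_on \<Omega>)"
      "(\<lambda>x. w x powr (- \<delta>) + g x (w x)) \<in> borel_measurable (lebesgue_on \<Omega>)"
  shows "integrable (lebesgue_on \<Omega>) (\<lambda>x. (w x powr (- \<delta>) + g x (w x)) * w x)"
proof (rule Bochner_Integration.integrable_bound)
  let ?E = "\<lambda>x. w x powr (1 - \<delta>) + C * (\<bar>g x (C * u0 x)\<bar> * u0 x)
    + C * (C / c) powr (r - 1) * (\<bar>g x (c * u0 x)\<bar> * u0 x)"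
  show "integrable (lebesgue_on \<Omega>) ?E"
    by (intro Bochner_Integration.integrable_add integrable_mult_right int)
  show "(\<lambda>x. (w x powr (- \<delta>) + g x (w x)) * w x) \<in> borel_measurable (lebesgue_on \<Omega>)"
    using meas by measurable
  show "AE x in lebesgue_on \<Omega>. norm ((w x powr (- \<delta>) + g x (w x)) * w x) \<le> norm (?E x)"
    using gdecr pos bounds
  proof eventually_elim
    case (elim x)
    have w: "0 < c * u0 x" "0 < w x"
      using elim c mult_pos_pos[of c "u0 x"] by linarith+
    have g: "\<bar>g x (w x)\<bar> \<le> \<bar>g x (C * u0 x)\<bar> + (C * u0 x / (c * u0 x)) powr (r - 1) * \<bar>g x (c * u0 x)\<bar>"
      using elim w r by (intro abs_between_quotient_decreasing) auto
    have "\<bar>(w x powr (- \<delta>) + g x (w x)) * w x\<bar> \<le> w x powr (1 - \<delta>) + \<bar>g x (w x)\<bar> * w x"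
    proof -
      have "w x powr (- \<delta>) * w x = w x powr (1 - \<delta>)"
        using w powr_mult_base[of "w x" "- \<delta>"] by (simp add: mult.commute)
      then show ?thesis
        using w abs_triangle_ineq[of "w x powr (- \<delta>) * w x" "g x (w x) * w x"]
        by (simp add: distrib_right abs_mult)
    qed
    also have "\<bar>g x (w x)\<bar> * w x \<le>
        (\<bar>g x (C * u0 x)\<bar> + (C * u0 x / (c * u0 x)) powr (r - 1) * \<bar>g x (c * u0 x)\<bar>) * (C * u0 x)"
      using g w elim by (intro mult_mono) auto
    also have "w x powr (1 - \<delta>) + \<dots> = ?E x"
      using elim(2) by (simp add: algebra_simps)
    finally show ?case by simp
  qed
qed

text \<open>After division by \<open>a powr r\<close> the two sides are the quotients
  \<open>(s powr (- \<delta>) + G s) / s powr (r - 1)\<close> at \<open>s = a\<close> and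
  \<open>s = b\<close>. Strictness comes from the singular term. The exponentials keep the form in
  which they occur in \<open>picone_test\<close> for \<open>\<beta> = 1\<close> and
  \<open>\<beta> = r\<close>.\<close>

lemma reaction_strict_decreasing:
  fixes G :: "real \<Rightarrow> real"
  assumes r: "1 < r" and \<delta>: "0 < \<delta>"
    and decr: "\<forall>s t. 0 < s \<and> s < t \<longrightarrow> G t / t powr (r - 1) \<le> G s / s powr (r - 1)"
    and ab: "0 < b" "b < a"
  shows "(a powr (- \<delta>) + G a) * exp (1 * ln a + (1 - 1) * ln b)
    < (b powr (- \<delta>) + G b) * exp (r * ln a + (1 - r) * ln b)"
proof -
  have a0: "0 < a" using ab by simp
  have q: "(z powr (- \<delta>) + G z) / z powr (r - 1) = z powr (- \<delta> - (r - 1)) + G z / z powr (r - 1)" for z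
    by (simp only: add_divide_distrib powr_diff)
  have "a powr (- \<delta> - (r - 1)) < b powr (- \<delta> - (r - 1))"
    using ab r \<delta> by (intro powr_less_mono2_neg) auto
  then have less: "(a powr (- \<delta>) + G a) / a powr (r - 1) < (b powr (- \<delta>) + G b) / b powr (r - 1)"
    unfolding q using decr ab by (intro add_less_le_mono) auto
  have ea: "exp (1 * ln a + (1 - 1) * ln b) = a powr r / a powr (r - 1)"
    using a0 by (simp add: powr_diff)
  have eb: "exp (r * ln a + (1 - r) * ln b) = a powr r / b powr (r - 1)"
    using a0 ab by (simp add: powr_def exp_diff[symmetric] algebra_simps)
  show ?thesis
    unfolding ea eb using mult_strict_left_mono[OF less, of "a powr r"] a0 by (simp add: mult.commute)
qed

theorem theorem3p1:
  fixes \<Omega> :: "(real^'n) set"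
    and g :: "real^'n \<Rightarrow> real \<Rightarrow> real"
    and u v u0 :: "real^'n \<Rightarrow> real"
    and \<delta> r c C :: real
  assumes dom: "bounded_smooth_domain \<Omega>"
    and delta: "\<delta> > 0"
    and r: "1 < r"
    and carath: "caratheodory \<Omega> g"
    and gbelow: "\<exists>m. AE x in lebesgue_on \<Omega>. \<forall>s>0. m \<le> g x s"
    and gdecr: "AE x in lebesgue_on \<Omega>. \<forall>s t. 0 < s \<and> s < t \<longrightarrow>
                   g x t / t powr (r - 1) \<le> g x s / s powr (r - 1)"
    and uLinf: "Linf_fun \<Omega> u" and vLinf: "Linf_fun \<Omega> v"
    and upos: "AE x in lebesgue_on \<Omega>. u x > 0"
    and vpos: "AE x in lebesgue_on \<Omega>. v x > 0"
    and uint: "integrable (lebesgue_on \<Omega>) (\<lambda>x. u x powr (1 - \<delta>))"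
    and vint: "integrable (lebesgue_on \<Omega>) (\<lambda>x. v x powr (1 - \<delta>))"
    and usub: "weak_subsol \<Omega> r \<delta> g u"
    and vsup: "weak_supersol \<Omega> r \<delta> g v"
    and u0Linf: "Linf_fun \<Omega> u0"
    and u0pos: "AE x in lebesgue_on \<Omega>. u0 x > 0"
    and c: "c > 0" and C: "C > 0"
    and ubounds: "AE x in lebesgue_on \<Omega>. c * u0 x \<le> u x \<and> u x \<le> C * u0 x"
    and vbounds: "AE x in lebesgue_on \<Omega>. c * u0 x \<le> v x \<and> v x \<le> C * u0 x"
    and gc: "integrable (lebesgue_on \<Omega>) (\<lambda>x. \<bar>g x (c * u0 x)\<bar> * u0 x)"
    and gC: "integrable (lebesgue_on \<Omega>) (\<lambda>x. \<bar>g x (C * u0 x)\<bar> * u0 x)"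
  shows "AE x in lebesgue_on \<Omega>. u x \<le> v x"
proof -
  let ?M = "lebesgue_on \<Omega>"
  have \<Omega>: "open \<Omega>" "bounded \<Omega>" using dom by (auto simp: bounded_smooth_domain_def)
  have r0: "0 < r" using r by simp
  have meas [measurable]: "u \<in> borel_measurable ?M" "v \<in> borel_measurable ?M"
    using uLinf vLinf by (auto simp: Linf_fun_def)
  define hu where "hu x = u x powr (- \<delta>) + g x (u x)" for x
  define hv where "hv x = v x powr (- \<delta>) + g x (v x)" for x
  obtain U where U: "W01_fun \<Omega> r u U"
    and subsol: "\<And>p. test_fun \<Omega> p \<Longrightarrow> (\<And>x. 0 \<le> p x) \<Longrightarrow> integrable ?M (\<lambda>x. hu x * p x)"
      "\<And>p. test_fun \<Omega> p \<Longrightarrow> (\<And>x. 0 \<le> p x) \<Longrightarrow>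
        (\<integral>x. norm (U x) powr (r - 2) * (U x \<bullet> grad p x) \<partial>?M) \<le> (\<integral>x. hu x * p x \<partial>?M)"
    using usub unfolding weak_subsol_def hu_def by blast
  obtain V where V: "W01_fun \<Omega> r v V"
    and supersol: "\<And>p. test_fun \<Omega> p \<Longrightarrow> (\<And>x. 0 \<le> p x) \<Longrightarrow> integrable ?M (\<lambda>x. hv x * p x)"
      "\<And>p. test_fun \<Omega> p \<Longrightarrow> (\<And>x. 0 \<le> p x) \<Longrightarrow>
        (\<integral>x. norm (V x) powr (r - 2) * (V x \<bullet> grad p x) \<partial>?M) \<ge> (\<integral>x. hv x * p x \<partial>?M)"
    using vsup unfolding weak_supersol_def hv_def by blast
  have grad_meas [measurable]: "U \<in> borel_measurable ?M" "V \<in> borel_measurable ?M"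
    using U V by (auto simp: W01_fun_def weak_grad_def)
  obtain \<phi> Du where \<phi>: "\<And>k. test_fun \<Omega> (\<phi> k)" "integrable ?M Du"
    "AE x in ?M. (\<lambda>k. \<phi> k x) \<longlonglongrightarrow> u x" "AE x in ?M. (\<lambda>k. grad (\<phi> k) x) \<longlonglongrightarrow> U x"
    "AE x in ?M. \<forall>k. norm (grad (\<phi> k) x) powr r \<le> Du x" "AE x in ?M. norm (U x) powr r \<le> Du x"
    using W01_fun_approx[OF \<Omega> r0 U] by blast
  obtain \<psi> Dv where \<psi>: "\<And>k. test_fun \<Omega> (\<psi> k)" "integrable ?M Dv"
    "AE x in ?M. (\<lambda>k. \<psi> k x) \<longlonglongrightarrow> v x" "AE x in ?M. (\<lambda>k. grad (\<psi> k) x) \<longlonglongrightarrow> V x"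
    "AE x in ?M. \<forall>k. norm (grad (\<psi> k) x) powr r \<le> Dv x" "AE x in ?M. norm (V x) powr r \<le> Dv x"
    using W01_fun_approx[OF \<Omega> r0 V] by blast
  define A where "A X = norm X powr (r - 2) *\<^sub>R X" for X :: "real^'n"
  have A_meas: "(\<lambda>x. A (U x)) \<in> borel_measurable ?M" "(\<lambda>x. - A (V x)) \<in> borel_measurable ?M"
    unfolding A_def by measurable
  have hu_meas [measurable]: "hu \<in> borel_measurable ?M"
    by (rule borel_measurable_of_test_functions[OF \<Omega>(1) \<phi>(1) _ \<phi>(3) upos subsol(1)]) auto
  have hv_meas [measurable]: "hv \<in> borel_measurable ?M"
    by (rule borel_measurable_of_test_functions[OF \<Omega>(1) \<psi>(1) _ \<psi>(3) vpos supersol(1)]) auto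
  \<comment> \<open>One majorant for every pairing of a flux with a gradient: each of the two powers
    in \<open>norm_p_flux_mult_le\<close> is at most \<open>Du x + Dv x\<close>.\<close>
  define D where "D x = 2 * (Du x + Dv x)" for x
  have iD: "integrable ?M D"
    unfolding D_def using \<phi>(2) \<psi>(2) by simp
  have flux: "norm (A X) * norm Y \<le> D x"
    if "norm X powr r \<le> Du x \<or> norm X powr r \<le> Dv x" "norm Y powr r \<le> Du x \<or> norm Y powr r \<le> Dv x"
      "norm (U x) powr r \<le> Du x" "norm (V x) powr r \<le> Dv x" for X Y :: "real^'n" and x
  proof -
    have "0 \<le> Du x" "0 \<le> Dv x"
      using that order_trans[OF powr_ge_zero] by blast+
    then have XY: "norm X powr r \<le> Du x + Dv x" "norm Y powr r \<le> Du x + Dv x"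
      using that(1,2) by linarith+
    have "norm (A X) * norm Y \<le> norm X powr r + norm Y powr r"
      unfolding A_def by (rule norm_p_flux_mult_le[OF r])
    also have "\<dots> \<le> (Du x + Dv x) + (Du x + Dv x)"
      by (rule add_mono[OF XY])
    also have "\<dots> = D x"
      by (simp add: D_def)
    finally show ?thesis .
  qed
  \<comment> \<open>From \<open>u \<le> C * u0 = (C / c) * (c * u0) \<le> (C / c) * v\<close>, and
    symmetrically. The maximum with 1 secures \<open>1 \<le> K\<close>.\<close>
  define K where "K = max 1 (C / c)"
  have K: "1 \<le> K" by (simp add: K_def)
  have cone: "AE x in ?M. 0 < v x \<and> v x \<le> K * u x \<and> u x \<le> K * v x"
    using u0pos ubounds vbounds vpos upos
  proof eventually_elim
    case (elim x)
    have le: "C * u0 x \<le> K * w" if "c * u0 x \<le> w" "0 < w" for w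
    proof -
      have "C * u0 x = C / c * (c * u0 x)" using c by simp
      also have "\<dots> \<le> C / c * w" using that c C by (intro mult_left_mono) auto
      also have "\<dots> \<le> K * w" using that by (intro mult_right_mono) (auto simp: K_def)
      finally show ?thesis .
    qed
    show ?case using elim le[of "u x"] le[of "v x"] by linarith
  qed
  have int_hu: "integrable ?M (\<lambda>x. hu x * u x)"
    using reaction_integrable[OF r gdecr u0pos c C ubounds uint gc gC] hu_meas unfolding hu_def by simp
  have int_hvv: "integrable ?M (\<lambda>x. hv x * v x)"
    using reaction_integrable[OF r gdecr u0pos c C vbounds vint gc gC] hv_meas unfolding hv_def by simp
  \<comment> \<open>The inequality for \<open>v\<close> is also tested with functions of the size of
    \<open>u\<close>, so \<open>hv\<close> must be integrable against \<open>u\<close>; this follows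
    from \<open>u \<le> K * v\<close>.\<close>
  have int_hv: "integrable ?M (\<lambda>x. - hv x * u x)"
  proof (rule Bochner_Integration.integrable_bound)
    show "integrable ?M (\<lambda>x. K * (hv x * v x))" using int_hvv by simp
    show "AE x in ?M. norm (- hv x * u x) \<le> norm (K * (hv x * v x))"
      using cone upos
    proof eventually_elim
      case (elim x)
      have "\<bar>hv x\<bar> * u x \<le> \<bar>hv x\<bar> * (K * v x)" using elim by (intro mult_left_mono) auto
      then show ?case using elim K by (simp add: abs_mult mult_ac)
    qed
  qed measurable
  interpret u: weak_inequality \<Omega> \<phi> \<psi> u v hu D U V "\<lambda>x. A (U x)"
  proof
    show "AE x in ?M. \<forall>k. norm (A (U x)) * norm (grad (\<phi> k) x) \<le> D x"
      using \<phi>(5,6) \<psi>(6) by eventually_elim (blast intro: flux)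
    show "AE x in ?M. \<forall>k. norm (A (U x)) * norm (grad (\<psi> k) x) \<le> D x"
      using \<psi>(5,6) \<phi>(6) by eventually_elim (blast intro: flux)
    show "AE x in ?M. norm (A (U x)) * norm (U x) \<le> D x" "AE x in ?M. norm (A (U x)) * norm (V x) \<le> D x"
      using \<psi>(6) \<phi>(6) by (eventually_elim, blast intro: flux)+
    show "(\<integral>x. A (U x) \<bullet> grad p x \<partial>?M) \<le> (\<integral>x. hu x * p x \<partial>?M)" if "test_fun \<Omega> p" "\<And>x. 0 \<le> p x" for p
      using subsol(2)[OF that] by (simp add: A_def)
  qed (fact \<phi>(1) \<psi>(1) \<phi>(3,4) \<psi>(3,4) upos iD subsol(1) meas grad_meas A_meas(1) hu_meas)+
  \<comment> \<open>Only the flux and the reaction term change. The cutoff is still built from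
    \<open>\<phi>\<close>, which converges to \<open>u\<close>.\<close>
  interpret v: weak_inequality \<Omega> \<phi> \<psi> u v "\<lambda>x. - hv x" D U V "\<lambda>x. - A (V x)"
  proof
    show "AE x in ?M. \<forall>k. norm (- A (V x)) * norm (grad (\<phi> k) x) \<le> D x"
      using \<phi>(5,6) \<psi>(6) unfolding norm_minus_cancel by eventually_elim (blast intro: flux)
    show "AE x in ?M. \<forall>k. norm (- A (V x)) * norm (grad (\<psi> k) x) \<le> D x"
      using \<psi>(5,6) \<phi>(6) unfolding norm_minus_cancel by eventually_elim (blast intro: flux)
    show "AE x in ?M. norm (- A (V x)) * norm (U x) \<le> D x" "AE x in ?M. norm (- A (V x)) * norm (V x) \<le> D x"
      using \<psi>(6) \<phi>(6) unfolding norm_minus_cancel by (eventually_elim, blast intro: flux)+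
    show "(\<integral>x. - A (V x) \<bullet> grad p x \<partial>?M) \<le> (\<integral>x. - hv x * p x \<partial>?M)" if "test_fun \<Omega> p" "\<And>x. 0 \<le> p x" for p
      using supersol(2)[OF that] by (simp add: A_def)
    show "integrable ?M (\<lambda>x. - hv x * p x)" if "test_fun \<Omega> p" "\<And>x. 0 \<le> p x" for p
      using supersol(1)[OF that] by simp
    show "(\<lambda>x. - hv x) \<in> borel_measurable ?M" by measurable
  qed (fact \<phi>(1) \<psi>(1) \<phi>(3,4) \<psi>(3,4) upos iD meas grad_meas A_meas(2))+
  let ?P = "\<lambda>\<beta> n x. picone_test \<beta> (real n) (u x) (v x)"
  let ?L = "\<lambda>\<beta> n x. picone_test_a \<beta> (real n) (u x) (v x) *\<^sub>R U x + picone_test_b \<beta> (real n) (u x) (v x) *\<^sub>R V x"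
  let ?E = "\<lambda>\<beta> x. exp (\<beta> * ln (u x) + (1 - \<beta>) * ln (v x))"
  note pu = u.picone_weak_inequality[OF of_nat_0_le_iff K cone int_hu]
  note pv = v.picone_weak_inequality[OF of_nat_0_le_iff K cone int_hv]
  have nonneg: "0 \<le> (\<integral>x. hu x * ?P 1 n x + - hv x * ?P r n x \<partial>?M)" for n
  proof -
    have "0 \<le> (\<integral>x. A (U x) \<bullet> ?L 1 n x + - A (V x) \<bullet> ?L r n x \<partial>?M)"
    proof (rule integral_nonneg_AE)
      show "AE x in ?M. 0 \<le> A (U x) \<bullet> ?L 1 n x + - A (V x) \<bullet> ?L r n x"
        using upos vpos
      proof eventually_elim
        case (elim x)
        show ?case
          using picone_pointwise[OF r of_nat_0_le_iff elim, of "U x" n "V x"] by (simp add: A_def)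
      qed
    qed
    also have "\<dots> = (\<integral>x. A (U x) \<bullet> ?L 1 n x \<partial>?M) + (\<integral>x. - A (V x) \<bullet> ?L r n x \<partial>?M)"
      by (rule Bochner_Integration.integral_add[OF pu(2) pv(2)])
    also have "\<dots> \<le> (\<integral>x. hu x * ?P 1 n x \<partial>?M) + (\<integral>x. - hv x * ?P r n x \<partial>?M)"
      by (intro add_mono pu(1) pv(1))
    also have "\<dots> = (\<integral>x. hu x * ?P 1 n x + - hv x * ?P r n x \<partial>?M)"
      by (rule Bochner_Integration.integral_add[OF pu(3) pv(3), symmetric])
    finally show ?thesis .
  qed
  \<comment> \<open>The pointwise limit of the logistic factor. The value \<open>1 / 2\<close> on
    the set where \<open>u\<close> and \<open>v\<close> agree is \<open>logistic 0\<close>; the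
    other factor of \<open>F\<close> vanishes there.\<close>
  define q where "q x = (if v x < u x then 1 else if v x = u x then 1 / 2 else (0 :: real))" for x
  have [measurable]: "q \<in> borel_measurable ?M" unfolding q_def by measurable
  define F where "F x = (hu x * ?E 1 x + - hv x * ?E r x) * q x" for x
  have [measurable]: "F \<in> borel_measurable ?M" unfolding F_def by measurable
  have PE: "?P \<beta> n x = ?E \<beta> x * logistic (real n * (ln (v x) - ln (u x)))" for \<beta> n x
    by (simp add: picone_test_def)
  \<comment> \<open>At \<open>n = 0\<close> the logistic factor is the constant
    \<open>1 / 2\<close>. Integrability of the terms with \<open>n = 0\<close> thus supplies a
    majorant for all \<open>n\<close>.\<close>
  have E2: "?E \<beta> x = 2 * ?P \<beta> 0 x" for \<beta> x
    unfolding PE by (simp add: logistic_def)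
  have lim: "0 \<le> integral\<^sup>L ?M F \<and> integrable ?M F"
  proof -
    \<comment> \<open>The smaller side is constantly zero, so the limit lemma transfers
      nonnegativity of the integrals to \<open>F\<close> and yields its integrability.\<close>
    have "integral\<^sup>L ?M (\<lambda>x. 0 :: real) \<le> integral\<^sup>L ?M F \<and> integrable ?M (\<lambda>x. 0 :: real) \<and> integrable ?M F"
    proof (rule integral_le_dominated_limit_integrable[where F = "\<lambda>x. 0"])
      show "(\<integral>x. 0 \<partial>?M) \<le> (\<integral>x. hu x * ?P 1 n x + - hv x * ?P r n x \<partial>?M)" for n
        using nonneg by simp
      show "integrable ?M (\<lambda>x. 2 * (\<bar>hu x * ?P 1 0 x\<bar> + \<bar>- hv x * ?P r 0 x\<bar>))"
        by (intro integrable_mult_right Bochner_Integration.integrable_add Bochner_Integration.integrable_abs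
            pu(3) pv(3))
      show "AE x in ?M. \<forall>n. \<bar>hu x * ?P 1 n x + - hv x * ?P r n x\<bar>
          \<le> 2 * (\<bar>hu x * ?P 1 0 x\<bar> + \<bar>- hv x * ?P r 0 x\<bar>)"
      proof (intro AE_I2 allI)
        fix x n
        have "\<bar>y * ?P \<beta> n x\<bar> \<le> 2 * \<bar>y * ?P \<beta> 0 x\<bar>" for y \<beta>
        proof -
          have "\<bar>y * ?P \<beta> n x\<bar> = \<bar>y * ?E \<beta> x\<bar> * logistic (real n * (ln (v x) - ln (u x)))"
            by (simp add: PE abs_mult abs_of_pos[OF logistic_bounds(1)])
          also have "\<dots> \<le> \<bar>y * ?E \<beta> x\<bar> * 1"
            by (intro mult_left_mono less_imp_le[OF logistic_bounds(2)]) simp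
          finally show ?thesis
            unfolding E2 by (simp add: abs_mult)
        qed
        from this[of "hu x" 1] this[of "- hv x" r]
        show "\<bar>hu x * ?P 1 n x + - hv x * ?P r n x\<bar> \<le> 2 * (\<bar>hu x * ?P 1 0 x\<bar> + \<bar>- hv x * ?P r 0 x\<bar>)"
          unfolding distrib_left by (intro order_trans[OF abs_triangle_ineq] add_mono)
      qed
      show "AE x in ?M. (\<lambda>n. hu x * ?P 1 n x + - hv x * ?P r n x) \<longlonglongrightarrow> F x"
        using upos vpos
      proof eventually_elim
        case (elim x)
        have "(\<lambda>n. logistic (real n * (ln (v x) - ln (u x)))) \<longlonglongrightarrow> q x"
        proof (cases "u x" "v x" rule: linorder_cases)
          case less
          then show ?thesis
            using elim by (auto simp: q_def intro!: logistic_tendsto(2))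
        next
          case equal
          then show ?thesis
            by (simp add: q_def logistic_def)
        next
          case greater
          then show ?thesis
            using elim by (auto simp: q_def intro!: logistic_tendsto(1))
        qed
        then have "(\<lambda>n. (hu x * ?E 1 x + - hv x * ?E r x) * logistic (real n * (ln (v x) - ln (u x))))
            \<longlonglongrightarrow> (hu x * ?E 1 x + - hv x * ?E r x) * q x"
          by (intro tendsto_intros)
        then show ?case
          unfolding F_def PE by (simp add: algebra_simps)
      qed
    qed auto
    then show ?thesis by simp
  qed
  have sign: "AE x in ?M. F x \<le> 0 \<and> (v x < u x \<longrightarrow> F x < 0)"
    using upos vpos gdecr
  proof eventually_elim
    case (elim x)
    show ?case
    proof (cases "u x" "v x" rule: linorder_cases)
      case less
      then show ?thesis by (simp add: F_def q_def)
    next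
      case equal
      then show ?thesis by (simp add: F_def q_def hu_def hv_def algebra_simps)
    next
      case greater
      then have "F x = hu x * ?E 1 x - hv x * ?E r x"
        by (simp add: F_def q_def)
      also have "\<dots> < 0"
        unfolding diff_less_0_iff_less hu_def hv_def
        by (rule reaction_strict_decreasing[OF r delta elim(3) elim(2) greater])
      finally show ?thesis by simp
    qed
  qed
  \<comment> \<open>The integral of \<open>F\<close> is nonnegative while \<open>F \<le> 0\<close>,
    so \<open>F\<close> vanishes almost everywhere. Since \<open>F < 0\<close> wherever
    \<open>v x < u x\<close>, that set is null.\<close>
  have "integral\<^sup>L ?M (\<lambda>x. - F x) = 0"
  proof (rule antisym)
    show "integral\<^sup>L ?M (\<lambda>x. - F x) \<le> 0" using lim by simp
    show "0 \<le> integral\<^sup>L ?M (\<lambda>x. - F x)"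
      using sign by (intro integral_nonneg_AE) (auto elim: eventually_mono)
  qed
  then have "AE x in ?M. - F x = 0"
    using lim sign by (subst (asm) integral_nonneg_eq_0_iff_AE) (auto elim: eventually_mono)
  with sign show ?thesis
    by eventually_elim force
qed

end
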